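(* The universal theory of infinite free lattices is decidable. That is, there is an algorithm which, given a universal first-order sentence in the language of lattices, decides whether that sentence holds in the free lattice $\mathbf F_3$ on three generators (equivalently, in every free lattice $\mathbf F_\lambda$ on $\lambda \ge 3$ generators).
   Context: The language of lattices has the binary operation symbols $\vee,\wedge$ (and the derived relation $\le$). $\mathbf F_\lambda$ denotes the free lattice on $\lambda$ generators; it is infinite exactly when $\lambda\ge 3$. All free lattices $\mathbf F_\lambda$ with $\lambda\ge3$ have the same universal theory (and hence the same existential theory), which is what "the universal theory of infinite free lattices" refers to. *)

theory Defs
  imports "HOL-Library.Nat_Bijection" "HOL-Library.Numeral_Type"
begin

section \<open>Free lattices\<close>

datatype 'a lat_word =
    Gen 'a
  | Sup_word "'a lat_word" "'a lat_word"
  | Inf_word "'a lat_word" "'a lat_word"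

text \<open>The least congruence on words that contains all instances of the lattice identities.\<close>

inductive lat_eq :: "'a lat_word \<Rightarrow> 'a lat_word \<Rightarrow> bool" where
  lat_eq_refl: "lat_eq s s"
| lat_eq_sym: "lat_eq s t \<Longrightarrow> lat_eq t s"
| lat_eq_trans: "lat_eq s t \<Longrightarrow> lat_eq t u \<Longrightarrow> lat_eq s u"
| lat_eq_Sup: "lat_eq s s' \<Longrightarrow> lat_eq t t' \<Longrightarrow> lat_eq (Sup_word s t) (Sup_word s' t')"
| lat_eq_Inf: "lat_eq s s' \<Longrightarrow> lat_eq t t' \<Longrightarrow> lat_eq (Inf_word s t) (Inf_word s' t')"
| Sup_comm: "lat_eq (Sup_word s t) (Sup_word t s)"
| Inf_comm: "lat_eq (Inf_word s t) (Inf_word t s)"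
| Sup_assoc: "lat_eq (Sup_word (Sup_word s t) u) (Sup_word s (Sup_word t u))"
| Inf_assoc: "lat_eq (Inf_word (Inf_word s t) u) (Inf_word s (Inf_word t u))"
| Sup_absorb: "lat_eq (Sup_word s (Inf_word s t)) s"
| Inf_absorb: "lat_eq (Inf_word s (Sup_word s t)) s"

lemma equivp_lat_eq: "equivp lat_eq"
  by (intro equivpI reflpI sympI transpI) (blast intro: lat_eq.intros)+

quotient_type 'a free_lattice = "'a lat_word" / lat_eq
  by (rule equivp_lat_eq)

lift_definition generator :: "'a \<Rightarrow> 'a free_lattice" is Gen .

lemma lat_eq_Sup_idem: "lat_eq (Sup_word s s) s"
  by (meson Inf_absorb Sup_absorb lat_eq_Sup lat_eq_refl lat_eq_sym lat_eq_trans)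

lemma lat_eq_Inf_Sup: "lat_eq (Inf_word s t) s \<longleftrightarrow> lat_eq (Sup_word s t) t"
proof
  assume "lat_eq (Inf_word s t) s"
  then have "lat_eq (Sup_word t (Inf_word t s)) (Sup_word t s)"
    by (meson Inf_comm lat_eq_Sup lat_eq_refl lat_eq_trans)
  then show "lat_eq (Sup_word s t) t"
    by (meson Sup_absorb Sup_comm lat_eq_sym lat_eq_trans)
next
  assume "lat_eq (Sup_word s t) t"
  then have "lat_eq (Inf_word s (Sup_word s t)) (Inf_word s t)"
    by (meson lat_eq_Inf lat_eq_refl)
  then show "lat_eq (Inf_word s t) s"
    by (meson Inf_absorb lat_eq_sym lat_eq_trans)
qed

instantiation free_lattice :: (type) lattice
begin

lift_definition sup_free_lattice :: "'a free_lattice \<Rightarrow> 'a free_lattice \<Rightarrow> 'a free_lattice"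
  is Sup_word by (rule lat_eq_Sup)

lift_definition inf_free_lattice :: "'a free_lattice \<Rightarrow> 'a free_lattice \<Rightarrow> 'a free_lattice"
  is Inf_word by (rule lat_eq_Inf)

definition less_eq_free_lattice :: "'a free_lattice \<Rightarrow> 'a free_lattice \<Rightarrow> bool"
  where "less_eq_free_lattice x y \<longleftrightarrow> sup x y = y"

definition less_free_lattice :: "'a free_lattice \<Rightarrow> 'a free_lattice \<Rightarrow> bool"
  where "less_free_lattice x y \<longleftrightarrow> x \<le> y \<and> \<not> y \<le> x"

instance
proof
  have comm: "sup x y = sup y x" "inf x y = inf y x" for x y :: "'a free_lattice"
    by (transfer, rule Sup_comm Inf_comm)+
  have assoc: "sup (sup x y) z = sup x (sup y z)" "inf (inf x y) z = inf x (inf y z)"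
    for x y z :: "'a free_lattice"
    by (transfer, rule Sup_assoc Inf_assoc)+
  have absorb: "sup x (inf x y) = x" for x y :: "'a free_lattice"
    by (transfer, rule Sup_absorb)
  have idem: "sup x x = x" for x :: "'a free_lattice"
    by (transfer, rule lat_eq_Sup_idem)
  have inf_le: "x \<le> y \<longleftrightarrow> inf x y = x" for x y :: "'a free_lattice"
    unfolding less_eq_free_lattice_def by (transfer, simp add: lat_eq_Inf_Sup)
  fix x y z :: "'a free_lattice"
  show "x < y \<longleftrightarrow> x \<le> y \<and> \<not> y \<le> x"
    by (rule less_free_lattice_def)
  show "x \<le> x" "x \<le> y \<Longrightarrow> y \<le> z \<Longrightarrow> x \<le> z" "x \<le> y \<Longrightarrow> y \<le> x \<Longrightarrow> x = y"
    "x \<le> sup x y" "y \<le> sup x y" "y \<le> x \<Longrightarrow> z \<le> x \<Longrightarrow> sup y z \<le> x"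
    unfolding less_eq_free_lattice_def by (metis idem assoc comm)+
  show "inf x y \<le> x" "inf x y \<le> y"
    unfolding less_eq_free_lattice_def by (metis absorb comm)+
  show "x \<le> y \<Longrightarrow> x \<le> z \<Longrightarrow> x \<le> inf y z"
    unfolding inf_le by (metis assoc)
qed

end

primrec eval_word :: "('a \<Rightarrow> 'b::lattice) \<Rightarrow> 'a lat_word \<Rightarrow> 'b" where
  "eval_word h (Gen a) = h a"
| "eval_word h (Sup_word s t) = sup (eval_word h s) (eval_word h t)"
| "eval_word h (Inf_word s t) = inf (eval_word h s) (eval_word h t)"

lemma eval_word_cong: "lat_eq s t \<Longrightarrow> eval_word h s = eval_word h t"
  by (induction rule: lat_eq.induct)
     (simp_all add: ac_simps)

lift_definition free_ext :: "('a \<Rightarrow> 'b::lattice) \<Rightarrow> 'a free_lattice \<Rightarrow> 'b" is eval_word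
  by (rule eval_word_cong)

theorem free_lattice_universal:
  fixes h :: "'a \<Rightarrow> 'b::lattice"
  shows "\<exists>!H. (\<forall>x y. H (sup x y) = sup (H x) (H y)) \<and> (\<forall>x y. H (inf x y) = inf (H x) (H y))
    \<and> (\<forall>a. H (generator a) = h a)"
proof (rule ex1I[of _ "free_ext h"])
  show "(\<forall>x y. free_ext h (sup x y) = sup (free_ext h x) (free_ext h y))
    \<and> (\<forall>x y. free_ext h (inf x y) = inf (free_ext h x) (free_ext h y))
    \<and> (\<forall>a. free_ext h (generator a) = h a)"
    by (intro conjI allI; transfer; simp)
next
  fix H :: "'a free_lattice \<Rightarrow> 'b"
  assume H: "(\<forall>x y. H (sup x y) = sup (H x) (H y)) \<and> (\<forall>x y. H (inf x y) = inf (H x) (H y))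
    \<and> (\<forall>a. H (generator a) = h a)"
  have "H (abs_free_lattice w) = eval_word h w" for w
    by (induction w)
       (use H in \<open>simp_all flip: sup_free_lattice.abs_eq inf_free_lattice.abs_eq generator.abs_eq\<close>)
  then show "H = free_ext h"
    by (metis Quotient_abs_rep Quotient_free_lattice free_ext.abs_eq ext)
qed


section \<open>First-order sentences in the language of lattices\<close>

datatype lat_term =
    Var nat
  | Join lat_term lat_term
  | Meet lat_term lat_term

datatype lat_form =
    Eq lat_term lat_term
  | Le lat_term lat_term
  | Neg lat_form
  | Conj lat_form lat_form
  | Disj lat_form lat_form
  | Impl lat_form lat_form
  | Forall nat lat_form
  | Exists nat lat_form

primrec term_vars :: "lat_term \<Rightarrow> nat set" where
  "term_vars (Var n) = {n}"
| "term_vars (Join s t) = term_vars s \<union> term_vars t"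
| "term_vars (Meet s t) = term_vars s \<union> term_vars t"

primrec free_vars :: "lat_form \<Rightarrow> nat set" where
  "free_vars (Eq s t) = term_vars s \<union> term_vars t"
| "free_vars (Le s t) = term_vars s \<union> term_vars t"
| "free_vars (Neg p) = free_vars p"
| "free_vars (Conj p q) = free_vars p \<union> free_vars q"
| "free_vars (Disj p q) = free_vars p \<union> free_vars q"
| "free_vars (Impl p q) = free_vars p \<union> free_vars q"
| "free_vars (Forall n p) = free_vars p - {n}"
| "free_vars (Exists n p) = free_vars p - {n}"

primrec quantifier_free :: "lat_form \<Rightarrow> bool" where
  "quantifier_free (Eq s t) \<longleftrightarrow> True"
| "quantifier_free (Le s t) \<longleftrightarrow> True"
| "quantifier_free (Neg p) \<longleftrightarrow> quantifier_free p"
| "quantifier_free (Conj p q) \<longleftrightarrow> quantifier_free p \<and> quantifier_free q"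
| "quantifier_free (Disj p q) \<longleftrightarrow> quantifier_free p \<and> quantifier_free q"
| "quantifier_free (Impl p q) \<longleftrightarrow> quantifier_free p \<and> quantifier_free q"
| "quantifier_free (Forall n p) \<longleftrightarrow> False"
| "quantifier_free (Exists n p) \<longleftrightarrow> False"

inductive universal_form :: "lat_form \<Rightarrow> bool" where
  "quantifier_free p \<Longrightarrow> universal_form p"
| "universal_form p \<Longrightarrow> universal_form (Forall n p)"

definition universal_sentence :: "lat_form \<Rightarrow> bool" where
  "universal_sentence p \<longleftrightarrow> universal_form p \<and> free_vars p = {}"

primrec eval_term :: "(nat \<Rightarrow> 'l::lattice) \<Rightarrow> lat_term \<Rightarrow> 'l" where
  "eval_term e (Var n) = e n"
| "eval_term e (Join s t) = sup (eval_term e s) (eval_term e t)"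
| "eval_term e (Meet s t) = inf (eval_term e s) (eval_term e t)"

primrec sat :: "(nat \<Rightarrow> 'l::lattice) \<Rightarrow> lat_form \<Rightarrow> bool" where
  "sat e (Eq s t) \<longleftrightarrow> eval_term e s = eval_term e t"
| "sat e (Le s t) \<longleftrightarrow> eval_term e s \<le> eval_term e t"
| "sat e (Neg p) \<longleftrightarrow> \<not> sat e p"
| "sat e (Conj p q) \<longleftrightarrow> sat e p \<and> sat e q"
| "sat e (Disj p q) \<longleftrightarrow> sat e p \<or> sat e q"
| "sat e (Impl p q) \<longleftrightarrow> (sat e p \<longrightarrow> sat e q)"
| "sat e (Forall n p) \<longleftrightarrow> (\<forall>x. sat (e(n := x)) p)"
| "sat e (Exists n p) \<longleftrightarrow> (\<exists>x. sat (e(n := x)) p)"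

definition holds_in :: "'l::lattice itself \<Rightarrow> lat_form \<Rightarrow> bool" where
  "holds_in _ p \<longleftrightarrow> (\<forall>e :: nat \<Rightarrow> 'l. sat e p)"


section \<open>Algorithms\<close>

text \<open>
  The total recursive functions in the sense of Kleene: the least class of functions of
  finitely many natural numbers that contains the constant zero, the successor and the
  projections and is closed under composition, primitive recursion and minimization of
  functions that have a zero for all values of the parameters.
  An \<open>n\<close>-ary function is represented by a function on lists; only its values on lists of
  length \<open>n\<close> are meaningful.
\<close>

inductive total_recursive :: "nat \<Rightarrow> (nat list \<Rightarrow> nat) \<Rightarrow> bool" where
  zero: "total_recursive n (\<lambda>_. 0)"
| succ: "total_recursive 1 (\<lambda>xs. Suc (xs ! 0))"
| proj: "i < n \<Longrightarrow> total_recursive n (\<lambda>xs. xs ! i)"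
| comp: "total_recursive (length gs) f \<Longrightarrow> \<forall>g\<in>set gs. total_recursive n g \<Longrightarrow>
    total_recursive n (\<lambda>xs. f (map (\<lambda>g. g xs) gs))"
| prim_rec: "total_recursive n f \<Longrightarrow> total_recursive (Suc (Suc n)) g \<Longrightarrow>
    total_recursive (Suc n)
      (\<lambda>xs. rec_nat (f (tl xs)) (\<lambda>k r. g (k # r # tl xs)) (hd xs))"
| minim: "total_recursive (Suc n) f \<Longrightarrow> \<forall>xs. length xs = n \<longrightarrow> (\<exists>k. f (k # xs) = 0) \<Longrightarrow>
    total_recursive n (\<lambda>xs. LEAST k. f (k # xs) = 0)"

text \<open>Algorithms receive sentences through an injective Goedel numbering.\<close>

primrec term_code :: "lat_term \<Rightarrow> nat" where
  "term_code (Var n) = prod_encode (0, n)"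
| "term_code (Join s t) = prod_encode (1, prod_encode (term_code s, term_code t))"
| "term_code (Meet s t) = prod_encode (2, prod_encode (term_code s, term_code t))"

primrec form_code :: "lat_form \<Rightarrow> nat" where
  "form_code (Eq s t) = prod_encode (0, prod_encode (term_code s, term_code t))"
| "form_code (Le s t) = prod_encode (1, prod_encode (term_code s, term_code t))"
| "form_code (Neg p) = prod_encode (2, form_code p)"
| "form_code (Conj p q) = prod_encode (3, prod_encode (form_code p, form_code q))"
| "form_code (Disj p q) = prod_encode (4, prod_encode (form_code p, form_code q))"
| "form_code (Impl p q) = prod_encode (5, prod_encode (form_code p, form_code q))"
| "form_code (Forall n p) = prod_encode (6, prod_encode (n, form_code p))"
| "form_code (Exists n p) = prod_encode (7, prod_encode (n, form_code p))"

lemma term_code_inject: "term_code s = term_code t \<longleftrightarrow> s = t"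
  by (induction s arbitrary: t; case_tac t) (auto simp: prod_encode_eq)

lemma form_code_inject: "form_code p = form_code q \<longleftrightarrow> p = q"
  by (induction p arbitrary: q; case_tac q) (auto simp: prod_encode_eq term_code_inject)

definition decidable_universal_theory :: "'l::lattice itself \<Rightarrow> bool" where
  "decidable_universal_theory L \<longleftrightarrow>
    (\<exists>f. total_recursive 1 f \<and>
      (\<forall>p. universal_sentence p \<longrightarrow> f [form_code p] = (if holds_in L p then 1 else 0)))"

end

theory Submission
  imports Defs
begin

text \<open>
  By Whitman's theorem the order of a free lattice is decidable, and the free lattice on any finite
  number of generators embeds into the one on three generators; so a universal sentence fails in one
  of the lattices in question iff some assignment of words over \<open>nat\<close> refutes it. It remains
  to bound the size of such an assignment.

  Let \<open>S\<close> be the finite set of subterms of the sentence, evaluated in a free lattice. The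
  type of a word \<open>w\<close> is the pair of the sets \<open>U w\<close> and \<open>L w\<close> of the elements of
  \<open>S\<close> above and below \<open>w\<close>. There are at most \<open>4\<close> to the power \<open>card S\<close> types.
  A new solution is built from a sequence of types \<open>t\<close> by putting
  \<open>e t = (x t \<squnion> low t) \<sqinter> up t\<close> with a fresh generator \<open>x t\<close>. Here \<open>up t\<close> consists
  of the earlier elements \<open>e s\<close> with an element of \<open>S\<close> in \<open>U t \<inter> L s\<close>,
  and, for every join \<open>b = q \<squnion> r\<close> in \<open>U t\<close> with neither \<open>q\<close> nor \<open>r\<close> in
  \<open>U t\<close> (a blocked join), of the join of all earlier \<open>e s\<close> with
  \<open>b \<in> U s\<close>; \<open>low t\<close> is dual. By construction the elements belonging to the types of the
  members of \<open>S\<close> respect the order, the joins and the meets of \<open>S\<close>.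

  That no new inequality between them holds is proved by following Whitman's condition, viewed as a
  game: a derivation of \<open>e r \<le> e s\<close> descends along mediating elements of \<open>S\<close> or
  along blocked joins and meets, and the original words tell which alternatives refute it. The
  original words may be arbitrarily deep, whereas the sequence of types is short. This is repaired by
  introducing one new type per phase and repeating all types found so far in many rounds of that phase: the
  relation between types that is induced by late rounds stabilises by finiteness, which allows an induction on
  the size of the original words.
\<close>

section \<open>Whitman's solution of the word problem\<close>

text \<open>The clauses are tried in order: joins on the left and meets on the right split without
  loss, generators are join and meet prime, and the last clause is Whitman's condition. Every call
  shortens one side, so this is an algorithm.\<close>

function (sequential) wle :: "'a lat_word \<Rightarrow> 'a lat_word \<Rightarrow> bool" where
  "wle (Sup_word a b) t \<longleftrightarrow> wle a t \<and> wle b t"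
| "wle s (Inf_word c d) \<longleftrightarrow> wle s c \<and> wle s d"
| "wle (Gen x) (Gen y) \<longleftrightarrow> x = y"
| "wle (Gen x) (Sup_word c d) \<longleftrightarrow> wle (Gen x) c \<or> wle (Gen x) d"
| "wle (Inf_word a b) (Gen y) \<longleftrightarrow> wle a (Gen y) \<or> wle b (Gen y)"
| "wle (Inf_word a b) (Sup_word c d) \<longleftrightarrow>
    wle a (Sup_word c d) \<or> wle b (Sup_word c d) \<or> wle (Inf_word a b) c \<or> wle (Inf_word a b) d"
  by pat_completeness auto
termination by (relation "measure (\<lambda>(s, t). size s + size t)") auto

lemma wle_Inf [simp]: "wle s (Inf_word c d) \<longleftrightarrow> wle s c \<and> wle s d"
  by (induction s) auto

lemma wle_SupI1: "wle s c \<Longrightarrow> wle s (Sup_word c d)"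
  by (induction s) auto

lemma wle_SupI2: "wle s d \<Longrightarrow> wle s (Sup_word c d)"
  by (induction s) auto

lemma wle_InfI1: "wle a t \<Longrightarrow> wle (Inf_word a b) t"
  by (induction t) auto

lemma wle_InfI2: "wle b t \<Longrightarrow> wle (Inf_word a b) t"
  by (induction t) auto

lemma wle_refl [simp]: "wle s s"
  by (induction s) (auto intro: wle_SupI1 wle_SupI2 wle_InfI1 wle_InfI2)

text \<open>A cut elimination: the middle word is decomposed together with one of its neighbours,
  which lowers the total size.\<close>

lemma wle_trans: "wle s t \<Longrightarrow> wle t u \<Longrightarrow> wle s u"
proof (induction "size s + size t + size u" arbitrary: s t u rule: less_induct)
  case less
  note IH = less.hyps and st = less.prems(1) and tu = less.prems(2)
  show ?case
  proof (cases s)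
    case s: (Sup_word a b)
    then show ?thesis using st tu IH[of a t u] IH[of b t u] by auto
  next
    case s: (Gen x)
    show ?thesis
    proof (cases t)
      case (Gen y) then show ?thesis using s st tu by auto
    next
      case (Sup_word c d) then show ?thesis using s st tu IH[of s c u] IH[of s d u] by auto
    next
      case t: (Inf_word c d)
      \<comment> \<open>For a middle meet the shape of \<open>u\<close> decides: a meet
        \<open>u\<close> is split, and otherwise the derivation of \<open>wle t u\<close> passes to
        a factor of \<open>t\<close> or to a summand of \<open>u\<close>.\<close>
      show ?thesis
        by (cases u) (use s t st tu IH[of s c u] IH[of s d u] IH[of s t] in auto)
    qed
  next
    case s: (Inf_word a b)
    show ?thesis
    proof (cases t)
      case (Gen y)
      then have "wle a u \<or> wle b u" using s st tu IH[of a t u] IH[of b t u] by auto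
      then show ?thesis using s wle_InfI1 wle_InfI2 by metis
    next
      case t: (Sup_word c d)
      then have "wle a u \<or> wle b u \<or> wle s u"
        using s st tu IH[of a t u] IH[of b t u] IH[of s c u] IH[of s d u] by auto
      then show ?thesis using s wle_InfI1 wle_InfI2 by metis
    next
      case t: (Inf_word c d)
      show ?thesis
        by (cases u) (use s t st tu IH[of s c u] IH[of s d u] IH[of s t] in auto)
    qed
  qed
qed

lemma wle_sound: "wle s t \<Longrightarrow> eval_word h s \<le> eval_word h t"
  by (induction s t rule: wle.induct) (auto intro: le_supI1 le_supI2 le_infI1 le_infI2)

lemma lat_eq_wle: "lat_eq s t \<Longrightarrow> wle s t \<and> wle t s"
proof (induction rule: lat_eq.induct)
  case (lat_eq_trans s t u) then show ?case by (blast intro: wle_trans)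
qed (auto intro: wle_refl wle_SupI1 wle_SupI2 wle_InfI1 wle_InfI2)

lemma abs_eq_eval: "abs_free_lattice s = eval_word generator s"
  by (induction s)
    (simp_all flip: sup_free_lattice.abs_eq inf_free_lattice.abs_eq generator.abs_eq)

text \<open>Whitman's theorem. \<open>wle\<close> respects all lattice identities; conversely it is
  sound in every lattice, in particular in the free lattice itself with the generators as
  values.\<close>

lemma abs_le_iff: "abs_free_lattice s \<le> abs_free_lattice t \<longleftrightarrow> wle s t"
proof
  assume "abs_free_lattice s \<le> abs_free_lattice t"
  then have "abs_free_lattice (Sup_word s t) = abs_free_lattice t"
    by (simp add: less_eq_free_lattice_def sup_free_lattice.abs_eq)
  then have "lat_eq (Sup_word s t) t" by (simp add: free_lattice.abs_eq_iff)
  then show "wle s t" using lat_eq_wle by fastforce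
qed (simp add: abs_eq_eval wle_sound)

section \<open>Reduction to countably many generators\<close>

primrec bind_word :: "('a \<Rightarrow> 'b lat_word) \<Rightarrow> 'a lat_word \<Rightarrow> 'b lat_word" where
  "bind_word h (Gen x) = h x"
| "bind_word h (Sup_word s t) = Sup_word (bind_word h s) (bind_word h t)"
| "bind_word h (Inf_word s t) = Inf_word (bind_word h s) (bind_word h t)"

lemma wle_bind: "wle s t \<Longrightarrow> wle (bind_word h s) (bind_word h t)"
  by (induction s t rule: wle.induct)
    (auto intro: wle_refl wle_SupI1 wle_SupI2 wle_InfI1 wle_InfI2)

lemma bind_bind: "bind_word g (bind_word h s) = bind_word (bind_word g \<circ> h) s"
  by (induction s) auto

lemma set_bind: "set_lat_word (bind_word h s) = (\<Union>x\<in>set_lat_word s. set_lat_word (h x))"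
  by (induction s) auto

lemma finite_set_lat_word [simp]: "finite (set_lat_word s)"
  by (induction s) auto

section \<open>Universal sentences evaluated on words\<close>

primrec inst :: "(nat \<Rightarrow> 'a lat_word) \<Rightarrow> lat_term \<Rightarrow> 'a lat_word" where
  "inst \<theta> (Var n) = \<theta> n"
| "inst \<theta> (Join s t) = Sup_word (inst \<theta> s) (inst \<theta> t)"
| "inst \<theta> (Meet s t) = Inf_word (inst \<theta> s) (inst \<theta> t)"

text \<open>Quantifiers are skipped because validity quantifies over all assignments from outside,
  which absorbs a universal prefix.\<close>

primrec satw :: "(nat \<Rightarrow> 'a lat_word) \<Rightarrow> lat_form \<Rightarrow> bool" where
  "satw \<theta> (Eq s t) \<longleftrightarrow> wle (inst \<theta> s) (inst \<theta> t) \<and> wle (inst \<theta> t) (inst \<theta> s)"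
| "satw \<theta> (Le s t) \<longleftrightarrow> wle (inst \<theta> s) (inst \<theta> t)"
| "satw \<theta> (Neg p) \<longleftrightarrow> \<not> satw \<theta> p"
| "satw \<theta> (Conj p q) \<longleftrightarrow> satw \<theta> p \<and> satw \<theta> q"
| "satw \<theta> (Disj p q) \<longleftrightarrow> satw \<theta> p \<or> satw \<theta> q"
| "satw \<theta> (Impl p q) \<longleftrightarrow> (satw \<theta> p \<longrightarrow> satw \<theta> q)"
| "satw \<theta> (Forall n p) \<longleftrightarrow> satw \<theta> p"
| "satw \<theta> (Exists n p) \<longleftrightarrow> satw \<theta> p"

primrec atom_terms :: "lat_form \<Rightarrow> lat_term set" where
  "atom_terms (Eq s t) = {s, t}"
| "atom_terms (Le s t) = {s, t}"
| "atom_terms (Neg p) = atom_terms p"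
| "atom_terms (Conj p q) = atom_terms p \<union> atom_terms q"
| "atom_terms (Disj p q) = atom_terms p \<union> atom_terms q"
| "atom_terms (Impl p q) = atom_terms p \<union> atom_terms q"
| "atom_terms (Forall n p) = atom_terms p"
| "atom_terms (Exists n p) = atom_terms p"

lemma finite_atom_terms [simp]: "finite (atom_terms p)"
  by (induction p) auto

lemma finite_term_vars [simp]: "finite (term_vars s)"
  by (induction s) auto

text \<open>Truth depends only on the order among the atomic terms. Changing the generators and
  bounding a refutation both reduce to preserving this finite piece of order.\<close>

lemma satw_cong:
  assumes "\<forall>s\<in>atom_terms p. \<forall>t\<in>atom_terms p.
    wle (inst \<theta> s) (inst \<theta> t) \<longleftrightarrow> wle (inst \<eta> s) (inst \<eta> t)"
  shows "satw \<theta> p \<longleftrightarrow> satw \<eta> p"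
  using assms by (induction p) auto

lemma eval_term_abs: "eval_term (\<lambda>n. abs_free_lattice (\<theta> n)) s = abs_free_lattice (inst \<theta> s)"
  by (induction s) (simp_all add: sup_free_lattice.abs_eq inf_free_lattice.abs_eq)

lemma sat_abs:
  fixes \<theta> :: "nat \<Rightarrow> 'a lat_word"
  shows "quantifier_free p \<Longrightarrow> sat (\<lambda>n. abs_free_lattice (\<theta> n)) p \<longleftrightarrow> satw \<theta> p"
  by (induction p) (simp_all add: eval_term_abs abs_le_iff order_eq_iff[where 'a = "'a free_lattice"])

lemma holds_in_iff:
  assumes "universal_form p"
  shows "holds_in TYPE('a free_lattice) p \<longleftrightarrow> (\<forall>\<theta> :: nat \<Rightarrow> 'a lat_word. satw \<theta> p)"
  using assms
proof induction
  case (1 p)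
  have "\<exists>\<theta>. e = (\<lambda>n. abs_free_lattice (\<theta> n))" for e :: "nat \<Rightarrow> 'a free_lattice"
    by (rule exI[of _ "\<lambda>n. rep_free_lattice (e n)"])
      (simp add: Quotient_abs_rep[OF Quotient_free_lattice])
  then show ?case unfolding holds_in_def using sat_abs[OF 1] by metis
next
  case (2 p n)
  have "holds_in TYPE('a free_lattice) (Forall n p) \<longleftrightarrow> holds_in TYPE('a free_lattice) p"
    unfolding holds_in_def by simp (metis fun_upd_triv)
  with 2 show ?case by simp
qed

section \<open>Embeddings of free lattices by substitution\<close>

definition word_embedding :: "('a \<Rightarrow> 'b lat_word) \<Rightarrow> 'a set \<Rightarrow> bool" where
  "word_embedding \<rho> G \<longleftrightarrow> (\<forall>s t. set_lat_word s \<subseteq> G \<longrightarrow> set_lat_word t \<subseteq> G \<longrightarrow>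
    wle (bind_word \<rho> s) (bind_word \<rho> t) \<longrightarrow> wle s t)"

lemma word_embedding_inj:
  assumes "inj_on g G"
  shows "word_embedding (Gen \<circ> g) G"
proof -
  have "set_lat_word s \<subseteq> G \<Longrightarrow> set_lat_word t \<subseteq> G \<Longrightarrow>
    wle (bind_word (Gen \<circ> g) s) (bind_word (Gen \<circ> g) t) \<Longrightarrow> wle s t" for s t
    by (induction s t rule: wle.induct) (use assms in \<open>auto dest: inj_onD\<close>)
  then show ?thesis unfolding word_embedding_def by blast
qed

text \<open>The generators are join prime and meet prime, and every free lattice satisfies Whitman's
  condition, so independence of the images of the generators is all that is needed.\<close>

lemma word_embedding_criterion:
  assumes up: "\<And>x. x \<in> G \<Longrightarrow> \<exists>u. (\<forall>y\<in>G - {x}. wle (\<rho> y) u) \<and> \<not> wle (\<rho> x) u"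
    and lo: "\<And>x. x \<in> G \<Longrightarrow> \<exists>u. (\<forall>y\<in>G - {x}. wle u (\<rho> y)) \<and> \<not> wle u (\<rho> x)"
  shows "word_embedding \<rho> G"
proof -
  \<comment> \<open>By induction, every word over \<open>G\<close> that is not above the generator
    \<open>x\<close> has its image below the separating element \<open>u\<close>, while the image of
    \<open>x\<close> is not below \<open>u\<close>.\<close>
  have gl: "wle (Gen x) t"
    if x: "x \<in> G" and t: "set_lat_word t \<subseteq> G" and le: "wle (\<rho> x) (bind_word \<rho> t)" for x t
  proof (rule ccontr)
    assume n: "\<not> wle (Gen x) t"
    obtain u where u: "\<forall>y\<in>G - {x}. wle (\<rho> y) u" "\<not> wle (\<rho> x) u" using up[OF x] by blast
    have "set_lat_word t \<subseteq> G \<Longrightarrow> \<not> wle (Gen x) t \<Longrightarrow> wle (bind_word \<rho> t) u"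
      by (induction t) (use u in \<open>auto intro: wle_InfI1 wle_InfI2\<close>)
    with t n have "wle (bind_word \<rho> t) u" by simp
    from wle_trans[OF le this] u(2) show False by contradiction
  qed
  have gr: "wle t (Gen x)"
    if x: "x \<in> G" and t: "set_lat_word t \<subseteq> G" and le: "wle (bind_word \<rho> t) (\<rho> x)" for x t
  proof (rule ccontr)
    assume n: "\<not> wle t (Gen x)"
    obtain u where u: "\<forall>y\<in>G - {x}. wle u (\<rho> y)" "\<not> wle u (\<rho> x)" using lo[OF x] by blast
    have "set_lat_word t \<subseteq> G \<Longrightarrow> \<not> wle t (Gen x) \<Longrightarrow> wle u (bind_word \<rho> t)"
      by (induction t) (use u in \<open>auto intro: wle_SupI1 wle_SupI2\<close>)
    with t n have "wle u (bind_word \<rho> t)" by simp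
    from wle_trans[OF this le] u(2) show False by contradiction
  qed
  \<comment> \<open>Only the clauses with a generator call for \<open>gl\<close> and
    \<open>gr\<close>; the others commute with substitution, since images of joins and meets are
    joins and meets.\<close>
  have "set_lat_word s \<subseteq> G \<Longrightarrow> set_lat_word t \<subseteq> G \<Longrightarrow>
    wle (bind_word \<rho> s) (bind_word \<rho> t) \<Longrightarrow> wle s t" for s t
  proof (induction s t rule: wle.induct)
    case (3 x y) then show ?case using gl[of x "Gen y"] by auto
  next
    case (4 x c d) then show ?case using gl[of x "Sup_word c d"] by auto
  next
    case (5 a b y) then show ?case using gr[of y "Inf_word a b"] by auto
  qed auto
  then show ?thesis unfolding word_embedding_def by blast
qed

lemma word_embedding_comp:
  assumes "word_embedding \<delta> G" "word_embedding \<rho> H" "\<And>x. x \<in> G \<Longrightarrow> set_lat_word (\<delta> x) \<subseteq> H"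
  shows "word_embedding (bind_word \<rho> \<circ> \<delta>) G"
  unfolding word_embedding_def
proof (intro allI impI)
  fix s t assume st: "set_lat_word s \<subseteq> G" "set_lat_word t \<subseteq> G"
    and "wle (bind_word (bind_word \<rho> \<circ> \<delta>) s) (bind_word (bind_word \<rho> \<circ> \<delta>) t)"
  then have "wle (bind_word \<rho> (bind_word \<delta> s)) (bind_word \<rho> (bind_word \<delta> t))"
    by (simp add: bind_bind)
  moreover have "set_lat_word (bind_word \<delta> s) \<subseteq> H" "set_lat_word (bind_word \<delta> t) \<subseteq> H"
    using st assms(3) by (auto simp: set_bind subset_eq)
  ultimately show "wle s t" using assms(1,2) st unfolding word_embedding_def by blast
qed

section \<open>Finite joins and meets over a base word\<close>

fun join_list :: "'a lat_word list \<Rightarrow> 'a lat_word \<Rightarrow> 'a lat_word" where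
  "join_list [] z = z"
| "join_list (w # ws) z = Sup_word w (join_list ws z)"

fun meet_list :: "'a lat_word list \<Rightarrow> 'a lat_word \<Rightarrow> 'a lat_word" where
  "meet_list [] z = z"
| "meet_list (w # ws) z = Inf_word w (meet_list ws z)"

lemma join_list_wle [simp]: "wle (join_list ws z) t \<longleftrightarrow> (\<forall>w\<in>set ws. wle w t) \<and> wle z t"
  by (induction ws) auto

lemma wle_meet_list [simp]: "wle t (meet_list ws z) \<longleftrightarrow> (\<forall>w\<in>set ws. wle t w) \<and> wle t z"
  by (induction ws) auto

lemma wle_join_listI: "w \<in> set ws \<Longrightarrow> wle t w \<Longrightarrow> wle t (join_list ws z)"
  by (induction ws) (auto intro: wle_SupI1 wle_SupI2)

lemma wle_join_list_base: "wle t z \<Longrightarrow> wle t (join_list ws z)"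
  by (induction ws) (auto intro: wle_SupI1 wle_SupI2)

lemma meet_list_wleI: "w \<in> set ws \<Longrightarrow> wle w t \<Longrightarrow> wle (meet_list ws z) t"
  by (induction ws) (auto intro: wle_InfI1 wle_InfI2)

lemma meet_list_base_wle: "wle z t \<Longrightarrow> wle (meet_list ws z) t"
  by (induction ws) (auto intro: wle_InfI1 wle_InfI2)

lemma Gen_wle_join_list [simp]:
  "wle (Gen x) (join_list ws z) \<longleftrightarrow> (\<exists>w\<in>set ws. wle (Gen x) w) \<or> wle (Gen x) z"
  by (induction ws) auto

lemma meet_list_wle_Gen [simp]:
  "wle (meet_list ws z) (Gen x) \<longleftrightarrow> (\<exists>w\<in>set ws. wle w (Gen x)) \<or> wle z (Gen x)"
  by (induction ws) auto

lemma bind_join_list [simp]: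
  "bind_word h (join_list ws z) = join_list (map (bind_word h) ws) (bind_word h z)"
  by (induction ws) auto

lemma bind_meet_list [simp]:
  "bind_word h (meet_list ws z) = meet_list (map (bind_word h) ws) (bind_word h z)"
  by (induction ws) auto

lemma wle_if_gens_wle: "\<forall>x\<in>set_lat_word w. wle (Gen x) u \<Longrightarrow> wle w u"
  by (induction w) (auto intro: wle_InfI1)

lemma wle_if_wle_gens: "\<forall>x\<in>set_lat_word w. wle u (Gen x) \<Longrightarrow> wle u w"
  by (induction w) (auto intro: wle_SupI1)

section \<open>Finitely many generators inside three\<close>

text \<open>Four independent elements of the free lattice on three generators, found by a computer
  search.\<close>

definition four_words :: "nat lat_word list" where
  "four_words =
    [Inf_word (Sup_word (Gen 0) (Gen 2)) (Sup_word (Gen 1) (Inf_word (Gen 0) (Gen 2))),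
     Sup_word (Inf_word (Gen 1) (Gen 2)) (Inf_word (Gen 0) (Sup_word (Gen 1) (Gen 2))),
     Inf_word (Sup_word (Gen 0) (Inf_word (Gen 1) (Gen 2)))
       (Sup_word (Gen 2) (Inf_word (Gen 0) (Gen 1))),
     Sup_word (Inf_word (Gen 1) (Sup_word (Gen 0) (Gen 2)))
       (Inf_word (Gen 2) (Sup_word (Gen 0) (Gen 1)))]"

text \<open>Trades the generators 0 to 3 for four words over 0 to 2 and shifts the others down,
  which saves one generator.\<close>

definition step_word :: "nat \<Rightarrow> nat lat_word" where
  "step_word i = (if i < 4 then four_words ! i else Gen (i - 1))"

lemma less_4_cases: "(i::nat) < 4 \<Longrightarrow> i = 0 \<or> i = 1 \<or> i = 2 \<or> i = 3" by auto

lemma set_step_word: "i < Suc k \<Longrightarrow> 3 \<le> k \<Longrightarrow> set_lat_word (step_word i) \<subseteq> {..<k}"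
  by (cases "i < 4") (auto simp: step_word_def four_words_def dest!: less_4_cases)

definition other_words :: "nat \<Rightarrow> nat lat_word list" where
  "other_words i = map (\<lambda>j. four_words ! j) (filter (\<lambda>j. j \<noteq> i) [0, 1, 2, 3])"

definition bot3 :: "nat lat_word" where "bot3 = Inf_word (Gen 0) (Inf_word (Gen 1) (Gen 2))"
definition top3 :: "nat lat_word" where "top3 = Sup_word (Gen 0) (Sup_word (Gen 1) (Gen 2))"

text \<open>A finite computation with the clauses of \<open>wle\<close>. \<open>bot3\<close> and
  \<open>top3\<close> are the least and the greatest element on three generators, hence neutral as
  bases of the lists.\<close>

lemma four_words_independent:
  assumes "i < 4"
  shows "\<not> wle (four_words ! i) (join_list (other_words i) bot3)"
    "\<not> wle (meet_list (other_words i) top3) (four_words ! i)"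
  using less_4_cases[OF assms]
  by (elim disjE; simp add: four_words_def other_words_def bot3_def top3_def)+

lemma bind_four_words:
  assumes "i < 4" "h 0 = Gen 0" "h 1 = Gen 1" "h 2 = Gen 2"
  shows "bind_word h (four_words ! i) = four_words ! i"
  using less_4_cases[OF assms(1)] assms(2-) by (auto simp: four_words_def)

lemma other_words_mem: "j < 4 \<Longrightarrow> j \<noteq> i \<Longrightarrow> four_words ! j \<in> set (other_words i)"
  using less_4_cases[of j] by (auto simp: other_words_def)

lemma bind_other_words:
  assumes "h 0 = Gen 0" "h 1 = Gen 1" "h 2 = Gen 2"
  shows "map (bind_word h) (other_words i) = other_words i"
  using assms by (auto simp: other_words_def bind_four_words)

lemma step_embedding:
  assumes k: "3 \<le> k"
  shows "word_embedding step_word {..<Suc k}"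
proof (rule word_embedding_criterion)
  fix x assume x: "x \<in> {..<Suc k}"
  let ?lo = "\<lambda>j. if j < 3 then Gen j else bot3" and ?hi = "\<lambda>j. if j < 3 then Gen j else top3"
  let ?gs = "map Gen (filter (\<lambda>i. i \<noteq> x - 1) [0..<k])"
  show "\<exists>u. (\<forall>y\<in>{..<Suc k} - {x}. wle (step_word y) u) \<and> \<not> wle (step_word x) u"
  proof (cases "x < 4")
    case True
    let ?u = "join_list (other_words x @ map Gen [3..<k]) bot3"
    have "wle (step_word y) ?u" if "y < Suc k" "y \<noteq> x" for y
      using that k other_words_mem[of y x]
      by (intro wle_join_listI[of "step_word y"]) (auto simp: step_word_def image_iff)
    moreover have "\<not> wle (step_word x) ?u"
    proof
      assume "wle (step_word x) ?u"
      \<comment> \<open>Sending the generators from 3 on to \<open>bot3\<close> erases them from the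
        join and fixes the four words.\<close>
      from wle_bind[OF this, of ?lo] True
      have "wle (four_words ! x)
          (join_list (other_words x @ map (\<lambda>j. bind_word ?lo (Gen j)) [3..<k]) bot3)"
        by (simp add: step_word_def bind_four_words bind_other_words bot3_def o_def)
      moreover have "wle \<dots> (join_list (other_words x) bot3)"
        by (auto intro: wle_join_listI wle_join_list_base)
      ultimately show False using four_words_independent(1)[OF True] by (metis wle_trans)
    qed
    ultimately show ?thesis by auto
  next
    case False
    \<comment> \<open>Here \<open>step_word x\<close> is the generator \<open>x - 1\<close>, which
      is at least 3 and occurs in no other image; the base \<open>Gen 0\<close> differs from
      it.\<close>
    let ?u = "join_list ?gs (Gen 0)"
    have "wle (step_word y) ?u" if "y < Suc k" "y \<noteq> x" for y
    proof (rule wle_if_gens_wle, rule ballI)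
      fix z assume z: "z \<in> set_lat_word (step_word y)"
      then have "z < k" using set_step_word[OF that(1) k] by auto
      moreover have "z \<noteq> x - 1"
        using z that False by (cases "y < 4")
          (auto simp: step_word_def four_words_def dest!: less_4_cases)
      ultimately show "wle (Gen z) ?u" by auto
    qed
    moreover have "\<not> wle (step_word x) ?u" using False by (auto simp: step_word_def)
    ultimately show ?thesis by auto
  qed
  show "\<exists>u. (\<forall>y\<in>{..<Suc k} - {x}. wle u (step_word y)) \<and> \<not> wle u (step_word x)"
  proof (cases "x < 4")
    case True
    let ?u = "meet_list (other_words x @ map Gen [3..<k]) top3"
    have "wle ?u (step_word y)" if "y < Suc k" "y \<noteq> x" for y
      using that k other_words_mem[of y x]
      by (intro meet_list_wleI[of "step_word y"]) (auto simp: step_word_def image_iff)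
    moreover have "\<not> wle ?u (step_word x)"
    proof
      assume "wle ?u (step_word x)"
      from wle_bind[OF this, of ?hi] True
      have "wle (meet_list (other_words x @ map (\<lambda>j. bind_word ?hi (Gen j)) [3..<k]) top3)
          (four_words ! x)"
        by (simp add: step_word_def bind_four_words bind_other_words top3_def o_def)
      moreover have "wle (meet_list (other_words x) top3)
          (meet_list (other_words x @ map (\<lambda>j. bind_word ?hi (Gen j)) [3..<k]) top3)"
        by (auto intro: meet_list_wleI meet_list_base_wle)
      ultimately show False using four_words_independent(2)[OF True] by (metis wle_trans)
    qed
    ultimately show ?thesis by auto
  next
    case False
    let ?u = "meet_list ?gs (Gen 0)"
    have "wle ?u (step_word y)" if "y < Suc k" "y \<noteq> x" for y
    proof (rule wle_if_wle_gens, rule ballI)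
      fix z assume z: "z \<in> set_lat_word (step_word y)"
      then have "z < k" using set_step_word[OF that(1) k] by auto
      moreover have "z \<noteq> x - 1"
        using z that False by (cases "y < 4")
          (auto simp: step_word_def four_words_def dest!: less_4_cases)
      ultimately show "wle ?u (Gen z)" by auto
    qed
    moreover have "\<not> wle ?u (step_word x)" using False by (auto simp: step_word_def)
    ultimately show ?thesis by auto
  qed
qed

text \<open>Composes the steps that save one generator each. Up to three generators the identity
  serves.\<close>

lemma free_embeds_3:
  "\<exists>\<rho> :: nat \<Rightarrow> nat lat_word. (\<forall>i<k. set_lat_word (\<rho> i) \<subseteq> {..<3}) \<and> word_embedding \<rho> {..<k}"
proof (induction k)
  case 0
  show ?case using word_embedding_inj[of id "{}::nat set"] by auto
next
  case (Suc k)
  show ?case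
  proof (cases "3 \<le> k")
    case False
    then show ?thesis using word_embedding_inj[of id "{..<Suc k}"]
      by (intro exI[of _ "Gen \<circ> id"]) auto
  next
    case True
    obtain \<rho> :: "nat \<Rightarrow> nat lat_word"
      where \<rho>: "\<forall>i<k. set_lat_word (\<rho> i) \<subseteq> {..<3}" "word_embedding \<rho> {..<k}"
      using Suc by blast
    have "word_embedding (bind_word \<rho> \<circ> step_word) {..<Suc k}"
      using word_embedding_comp[OF step_embedding[OF True] \<rho>(2)] set_step_word True by auto
    moreover have "set_lat_word ((bind_word \<rho> \<circ> step_word) i) \<subseteq> {..<3}" if "i < Suc k" for i
      using set_step_word[OF that True] \<rho>(1) by (auto simp: set_bind subset_eq)
    ultimately show ?thesis by blast
  qed
qed

lemma inst_bind: "inst (bind_word \<rho> \<circ> \<theta>) s = bind_word \<rho> (inst \<theta> s)"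
  by (induction s) auto

lemma set_inst: "set_lat_word (inst \<theta> s) = (\<Union>n\<in>term_vars s. set_lat_word (\<theta> n))"
  by (induction s) auto

lemma satw_bind:
  assumes "word_embedding \<rho> G"
    and "\<And>s n. s \<in> atom_terms p \<Longrightarrow> n \<in> term_vars s \<Longrightarrow> set_lat_word (\<theta> n) \<subseteq> G"
  shows "satw (bind_word \<rho> \<circ> \<theta>) p \<longleftrightarrow> satw \<theta> p"
proof (rule satw_cong, intro ballI)
  fix s t assume "s \<in> atom_terms p" "t \<in> atom_terms p"
  then have "set_lat_word (inst \<theta> s) \<subseteq> G" "set_lat_word (inst \<theta> t) \<subseteq> G"
    using assms(2) by (auto simp: set_inst subset_eq)
  then show "wle (inst (bind_word \<rho> \<circ> \<theta>) s) (inst (bind_word \<rho> \<circ> \<theta>) t) \<longleftrightarrow>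
      wle (inst \<theta> s) (inst \<theta> t)"
    using assms(1) unfolding word_embedding_def by (auto simp: inst_bind wle_bind)
qed

text \<open>On the variables of the sentence a refutation uses finitely many generators. Those in
  \<open>nat\<close> are first squeezed into three, which then map injectively into
  \<open>'a\<close>; in the other direction an injection into \<open>nat\<close> suffices.\<close>

lemma satw_all_iff:
  assumes "infinite (UNIV :: 'a set) \<or> CARD('a) \<ge> 3"
  shows "(\<forall>\<theta> :: nat \<Rightarrow> 'a lat_word. satw \<theta> p) \<longleftrightarrow> (\<forall>\<theta> :: nat \<Rightarrow> nat lat_word. satw \<theta> p)"
proof (intro iffI allI)
  define V where "V = (\<Union>s\<in>atom_terms p. term_vars s)"
  have V: "finite V" unfolding V_def by auto
  {
    fix \<theta> :: "nat \<Rightarrow> nat lat_word"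
    assume all: "\<forall>\<theta> :: nat \<Rightarrow> 'a lat_word. satw \<theta> p"
    have "finite (\<Union>n\<in>V. set_lat_word (\<theta> n))" using V by auto
    then obtain k where "\<forall>x\<in>(\<Union>n\<in>V. set_lat_word (\<theta> n)). x < k" using finite_nat_set_iff_bounded by blast
    then have k: "set_lat_word (\<theta> n) \<subseteq> {..<k}" if "n \<in> V" for n using that by auto
    obtain \<rho> where \<rho>: "\<forall>i<k. set_lat_word (\<rho> i) \<subseteq> {..<3::nat}" "word_embedding \<rho> {..<k}"
      using free_embeds_3 by blast
    have "\<exists>A :: 'a set. finite A \<and> card A = 3"
    proof (cases "finite (UNIV :: 'a set)")
      case True
      with assms have "3 \<le> CARD('a)" by simp
      from obtain_subset_with_card_n[OF this] show ?thesis by blast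
    next
      case False
      then show ?thesis using infinite_arbitrarily_large by blast
    qed
    then obtain A :: "'a set" where A: "finite A" "card A = 3" by blast
    obtain g :: "nat \<Rightarrow> 'a" where "bij_betw g {0..<card A} A"
      using ex_bij_betw_nat_finite[OF A(1)] by blast
    then have g: "inj_on g {..<3}" using A(2) by (simp add: bij_betw_def atLeast0LessThan)
    have "word_embedding (bind_word (Gen \<circ> g) \<circ> \<rho>) {..<k}"
      by (rule word_embedding_comp[OF \<rho>(2) word_embedding_inj[OF g]]) (use \<rho>(1) in blast)
    then have "satw (bind_word (bind_word (Gen \<circ> g) \<circ> \<rho>) \<circ> \<theta>) p \<longleftrightarrow> satw \<theta> p"
      by (rule satw_bind) (use k V_def in blast)
    with all show "satw \<theta> p" by simp
  }
  {
    fix \<theta> :: "nat \<Rightarrow> 'a lat_word"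
    assume all: "\<forall>\<theta> :: nat \<Rightarrow> nat lat_word. satw \<theta> p"
    define G where "G = (\<Union>n\<in>V. set_lat_word (\<theta> n))"
    have "finite G" using V G_def by auto
    then obtain g :: "'a \<Rightarrow> nat" where g: "inj_on g G"
      using finite_imp_inj_to_nat_seg by metis
    have "satw (bind_word (Gen \<circ> g) \<circ> \<theta>) p \<longleftrightarrow> satw \<theta> p"
      by (rule satw_bind[OF word_embedding_inj[OF g]]) (use G_def V_def in blast)
    with all show "satw \<theta> p" by simp
  }
qed

section \<open>The separation game\<close>

lemma decreasing_sets_stabilise:
  assumes "finite A" "\<And>n. W n \<subseteq> A" "\<And>n. W (Suc n) \<subseteq> W n"
  shows "\<exists>n\<le>card A. W (Suc n) = W n"
proof (rule ccontr)
  assume "\<not> ?thesis"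
  then have lt: "W (Suc n) \<subset> W n" if "n \<le> card A" for n using assms(3) that by blast
  have "n \<le> Suc (card A) \<Longrightarrow> card (W n) + n \<le> card A" for n
  proof (induction n)
    case 0 then show ?case using card_mono[OF assms(1,2)] by simp
  next
    case (Suc n)
    then have "card (W (Suc n)) < card (W n)"
      using psubset_card_mono[OF finite_subset[OF assms(2) assms(1)] lt[of n]] by simp
    with Suc show ?case by simp
  qed
  from this[of "Suc (card A)"] show False by simp
qed

lemma mod_2_diff_2: "2 \<le> (i::nat) \<Longrightarrow> (i - 2) mod 2 = i mod 2"
  by (simp add: le_mod_geq[symmetric])

lemma mod_2_diff_4: "4 \<le> (i::nat) \<Longrightarrow> (i - 4) mod 2 = i mod 2"
  using mod_2_diff_2[of i] mod_2_diff_2[of "i - 2"] by simp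

section \<open>Types, phases and rounds\<close>

text \<open>
  The word \<open>rep g\<close> has the type with number \<open>g\<close>, and \<open>avail h w\<close> says that the types of
  all subwords of \<open>w\<close> have numbers below \<open>h\<close>. Position \<open>pos h i g\<close> carries the
  copy of type \<open>g\<close> in round \<open>i\<close> of phase \<open>h\<close>; only types \<open>g \<le> h\<close> occur in
  phase \<open>h\<close>, and the minimum in \<open>idx\<close> pads the remaining positions.
\<close>

locale frame =
  fixes le :: "'w \<Rightarrow> 'w \<Rightarrow> bool" and v :: "'p \<Rightarrow> 'w" and S :: "'p set"
    and blU blL :: "'w \<Rightarrow> 'p set" and comps :: "'w \<Rightarrow> 'w set" and sz :: "'w \<Rightarrow> nat"
    and avail :: "nat \<Rightarrow> 'w \<Rightarrow> bool" and rep :: "nat \<Rightarrow> 'w" and m M :: nat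
  fixes U L :: "'w \<Rightarrow> 'p set" and ph idx :: "nat \<Rightarrow> nat" and pos :: "nat \<Rightarrow> nat \<Rightarrow> nat \<Rightarrow> nat"
  defines U_def: "U w \<equiv> {p \<in> S. le w (v p)}"
    and L_def: "L w \<equiv> {p \<in> S. le (v p) w}"
    and ph_def: "ph t \<equiv> t div (M * m)"
    and idx_def: "idx t \<equiv> min (t mod m) (t div (M * m))"
    and pos_def: "pos h i g \<equiv> h * (M * m) + i * m + g"
  assumes fin: "finite S"
    and le_trans: "le x y \<Longrightarrow> le y z \<Longrightarrow> le x z"
    and blU_sub: "blU w \<subseteq> U w" and blL_sub: "blL w \<subseteq> L w"
    and blU_cong: "U w = U w' \<Longrightarrow> blU w = blU w'" and blL_cong: "L w = L w' \<Longrightarrow> blL w = blL w'"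
    and compU: "b \<in> blU w \<Longrightarrow> \<not> le w x \<Longrightarrow> \<exists>c\<in>comps w. b \<in> U c \<and> \<not> le c x"
    and compL: "a \<in> blL w \<Longrightarrow> \<not> le x w \<Longrightarrow> \<exists>c\<in>comps w. a \<in> L c \<and> \<not> le x c"
    and comps_sz: "c \<in> comps w \<Longrightarrow> sz c < sz w"
    and avail_type: "avail h w \<Longrightarrow> \<exists>g<h. U w = U (rep g) \<and> L w = L (rep g)"
    and avail_comps: "avail h w \<Longrightarrow> c \<in> comps w \<Longrightarrow> avail h c"
    and avail_mono: "avail h w \<Longrightarrow> h \<le> h' \<Longrightarrow> avail h' w"
    and rep_comps: "g < m \<Longrightarrow> c \<in> comps (rep g) \<Longrightarrow> avail g c"
    and M_large: "2 * m ^ 4 + 4 * card S + 12 \<le> M"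
begin

abbreviation "N \<equiv> m * (M * m)"
abbreviation "rd t \<equiv> (t div m) mod M"
abbreviation "w_at t \<equiv> rep (idx t)"

text \<open>A position is a number whose digits are phase, round and type index, with bases
  \<open>M\<close> and \<open>m\<close>; division recovers the digits.\<close>

lemma pos_facts:
  assumes "h < m" "i < M" "g \<le> h"
  shows "pos h i g < N" "ph (pos h i g) = h" "idx (pos h i g) = g" "rd (pos h i g) = i"
    "h < ph t \<Longrightarrow> pos h i g < t"
proof -
  have m: "g < m" "0 < m" "0 < M" using assms by auto
  have *: "i * m + g < M * m"
  proof -
    have "i * m + g < i * m + m" using m by simp
    also have "\<dots> = Suc i * m" by simp
    also have "\<dots> \<le> M * m" using assms by (intro mult_le_mono1) simp
    finally show ?thesis .
  qed
  have "pos h i g = h * (M * m) + (i * m + g)" by (simp add: pos_def)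
  then have lt: "pos h i g < Suc h * (M * m)" and d: "pos h i g div (M * m) = h"
    using * m by auto
  show "ph (pos h i g) = h" using d by (simp add: ph_def)
  have "Suc h * (M * m) \<le> m * (M * m)" using assms by (intro mult_le_mono1) simp
  with lt show "pos h i g < N" by linarith
  have e: "pos h i g = (h * M + i) * m + g" by (simp add: pos_def algebra_simps)
  have md: "pos h i g mod m = g" using m by (simp add: e)
  show "idx (pos h i g) = g" using md d assms by (simp add: idx_def)
  have "pos h i g div m = h * M + i" using m by (simp add: e)
  then show "rd (pos h i g) = i" using assms by simp
  assume "h < ph t"
  then have "Suc h * (M * m) \<le> t div (M * m) * (M * m)" by (intro mult_le_mono1) (simp add: ph_def)
  also have "\<dots> \<le> t" by simp
  finally show "pos h i g < t" using lt by linarith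
qed

lemma pos_less: "i < i' \<Longrightarrow> g < m \<Longrightarrow> pos h i g < pos h i' g'"
proof -
  assume a: "i < i'" "g < m"
  have "Suc i * m \<le> i' * m" using a by (intro mult_le_mono1) simp
  then show ?thesis using a by (simp add: pos_def)
qed

lemma ph_mono: "s \<le> t \<Longrightarrow> ph s \<le> ph t"
  by (simp add: ph_def div_le_mono)

lemma ph_less: "t < N \<Longrightarrow> ph t < m"
  by (simp add: ph_def less_mult_imp_div_less)

lemma idx_le_ph: "idx t \<le> ph t"
  by (simp add: idx_def ph_def)

lemma mediate_le: "U x \<inter> L y \<noteq> {} \<Longrightarrow> le x y"
  using le_trans unfolding U_def L_def by blast

lemma le_U: "le x y \<Longrightarrow> U y \<subseteq> U x"
  using le_trans unfolding U_def by blast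

lemma le_L: "le x y \<Longrightarrow> L x \<subseteq> L y"
  using le_trans unfolding L_def by blast

end

section \<open>The game and its dual\<close>

text \<open>
  \<open>R r r'\<close> stands for \<open>e r \<le> x r' \<squnion> low r'\<close>; the alternatives of \<open>R_step\<close> are the
  ways in which Whitman's condition can derive it. The locale is symmetric under duality, which exchanges
  the two arguments of \<open>R\<close>; to have both sides use disjoint copies, late positions have even rounds on one side
  and odd rounds on the other, according to \<open>par\<close>.
\<close>

locale game = frame +
  fixes R :: "nat \<Rightarrow> nat \<Rightarrow> bool" and par :: nat
  assumes par: "par < 2"
    and R_step: "r < N \<Longrightarrow> r' < N \<Longrightarrow> R r r' \<Longrightarrow> r = r'
      \<or> (\<exists>s<r. U (w_at r) \<inter> L (w_at s) \<noteq> {} \<and> R s r')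
      \<or> (\<exists>b\<in>blU (w_at r). \<forall>s<r. b \<in> U (w_at s) \<longrightarrow> R s r')
      \<or> (\<exists>s<r'. U (w_at s) \<inter> L (w_at r') \<noteq> {} \<and> R r s)
      \<or> (\<exists>a\<in>blL (w_at r'). \<forall>s<r'. a \<in> L (w_at s) \<longrightarrow> R r s)"
begin

text \<open>Reversing both \<open>le\<close> and \<open>R\<close> exchanges \<open>U\<close> with
  \<open>L\<close> and blocked joins with blocked meets. Statements about \<open>L\<close> then
  follow from those about \<open>U\<close>.\<close>

lemma dual_game:
  "game (\<lambda>x y. le y x) v S blL blU comps sz avail rep m M (\<lambda>x y. R y x) (1 - par)"
proof (unfold_locales, goal_cases)
  case 1 show ?case by (rule fin)
next
  case (2 x y z) then show ?case using le_trans by blast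
next
  case (3 w) show ?case using blL_sub[of w] unfolding L_def .
next
  case (4 w) show ?case using blU_sub[of w] unfolding U_def .
next
  case (5 w w') then show ?case using blL_cong[of w w'] unfolding L_def by simp
next
  case (6 w w') then show ?case using blU_cong[of w w'] unfolding U_def by simp
next
  case (7 b w x) then show ?case using compL[of b w x] unfolding L_def by simp
next
  case (8 a w x) then show ?case using compU[of a w x] unfolding U_def by simp
next
  case (9 c w) then show ?case by (rule comps_sz)
next
  case (10 h w) then show ?case using avail_type[of h w] unfolding U_def L_def by blast
next
  case (11 h w c) then show ?case by (rule avail_comps)
next
  case (12 h w h') then show ?case by (rule avail_mono)
next
  case (13 g c) then show ?case by (rule rep_comps)
next
  case 14 show ?case by (rule M_large)
next
  case 15 show ?case by simp
next
  case (16 r r')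
  let ?ix = "\<lambda>t. min (t mod m) (t div (M * m))"
  have *: "{p \<in> S. le (v p) x} \<inter> {p \<in> S. le y (v p)} = {p \<in> S. le y (v p)} \<inter> {p \<in> S. le (v p) x}"
    for x y by blast
  from R_step[OF 16(2,1,3)] show ?case unfolding U_def L_def ph_def idx_def *
    by (elim disjE) simp_all
qed

section \<open>Soundness of the game\<close>

definition type_mono :: "nat \<Rightarrow> nat \<Rightarrow> bool" where
  "type_mono h k \<longleftrightarrow> (\<forall>t t'. t < N \<longrightarrow> t' < N \<longrightarrow> ph t \<le> h \<longrightarrow> ph t' \<le> k \<longrightarrow> R t t' \<longrightarrow>
    U (w_at t') \<subseteq> U (w_at t) \<and> L (w_at t) \<subseteq> L (w_at t'))"

text \<open>Records which pairs of types are still related by \<open>R\<close> in late rounds. The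
  opposite parities keep the two positions distinct, so that the alternative \<open>r = r'\<close>
  of \<open>R_step\<close> cannot occur.\<close>

definition W :: "nat \<Rightarrow> (nat \<times> nat \<times> nat \<times> nat) set" where
  "W n = {(h, g, k, g'). h < m \<and> g \<le> h \<and> k < m \<and> g' \<le> k \<and> (\<exists>i j. i < M \<and> j < M \<and>
    2 * n \<le> i \<and> 2 * n \<le> j \<and> i mod 2 = par \<and> j mod 2 = 1 - par \<and> R (pos h i g) (pos k j g'))}"

lemma W_memI:
  "h < m \<Longrightarrow> g \<le> h \<Longrightarrow> k < m \<Longrightarrow> g' \<le> k \<Longrightarrow> i < M \<Longrightarrow> j < M \<Longrightarrow> 2 * n \<le> i \<Longrightarrow> 2 * n \<le> j \<Longrightarrow>
    i mod 2 = par \<Longrightarrow> j mod 2 = 1 - par \<Longrightarrow> R (pos h i g) (pos k j g') \<Longrightarrow> (h, g, k, g') \<in> W n"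
  unfolding W_def by blast

definition stable_round :: nat where
  "stable_round = (SOME n. n \<le> m ^ 4 \<and> W (Suc n) = W n)"

text \<open>\<open>W\<close> decreases inside a set of \<open>m ^ 4\<close> quadruples. A single
  repetition is enough, since \<open>late_sound\<close> always returns to the same index.\<close>

lemma stable_round: "stable_round \<le> m ^ 4" "W (Suc stable_round) = W stable_round"
proof -
  let ?A = "{..<m} \<times> {..<m} \<times> {..<m} \<times> {..<m}"
  have "W n \<subseteq> ?A" for n by (auto simp: W_def)
  moreover have "W (Suc n) \<subseteq> W n" for n
  proof -
    have "2 * n \<le> i" if "2 * Suc n \<le> i" for i using that by simp
    then show ?thesis unfolding W_def by blast
  qed
  ultimately have "\<exists>n\<le>card ?A. W (Suc n) = W n"
    by (intro decreasing_sets_stabilise) auto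
  moreover have "card ?A = m ^ 4" by (simp add: numeral_eq_Suc)
  ultimately have "\<exists>n. n \<le> m ^ 4 \<and> W (Suc n) = W n" by auto
  from someI_ex[OF this] show "stable_round \<le> m ^ 4" "W (Suc stable_round) = W stable_round"
    unfolding stable_round_def by auto
qed

text \<open>The game sees only types, yet the induction is on the size of the words \<open>c\<close>
  and \<open>x\<close>: stability provides fresh late rounds at every step, however deep these words
  are.\<close>

lemma late_sound:
  assumes Z: "type_mono h k"
  shows "avail (Suc h) c \<Longrightarrow> avail (Suc k) x \<Longrightarrow> U c = U (rep g) \<Longrightarrow> L c = L (rep g) \<Longrightarrow>
    U x = U (rep g') \<Longrightarrow> L x = L (rep g') \<Longrightarrow> (h, g, k, g') \<in> W stable_round \<Longrightarrow> le c x"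
proof (induction "sz c + sz x" arbitrary: c x g g' rule: less_induct)
  case less
  note c = less.prems(1) and x = less.prems(2) and Uc = less.prems(3) and Lc = less.prems(4)
    and Ux = less.prems(5) and Lx = less.prems(6)
  \<comment> \<open>Stability gives witnesses two rounds later, so rounds \<open>i - 2\<close> and
    \<open>j - 2\<close> still count for \<open>W stable_round\<close>.\<close>
  have "(h, g, k, g') \<in> W (Suc stable_round)" using less.prems(7) stable_round by simp
  then obtain i j where hk: "h < m" "k < m" "g \<le> h" "g' \<le> k" and ij: "i < M" "j < M"
      "2 * Suc stable_round \<le> i" "2 * Suc stable_round \<le> j" "i mod 2 = par" "j mod 2 = 1 - par"
    and Rij: "R (pos h i g) (pos k j g')"
    unfolding W_def by auto
  note P = pos_facts[OF hk(1) ij(1) hk(3)] and Q = pos_facts[OF hk(2) ij(2) hk(4)]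
  let ?r = "pos h i g" and ?r' = "pos k j g'"
  have ne: "?r \<noteq> ?r'"
  proof
    assume "?r = ?r'"
    then have "i = j" using P(4) Q(4) by simp
    with ij(5,6) par show False by presburger
  qed
  have Zs: "U (w_at s') \<subseteq> U (w_at s) \<and> L (w_at s) \<subseteq> L (w_at s')"
    if "s \<le> ?r" "s' \<le> ?r'" "R s s'" for s s'
  proof -
    have "ph s \<le> h" "ph s' \<le> k" "s < N" "s' < N"
      using that P(1,2) Q(1,2) ph_mono[of s ?r] ph_mono[of s' ?r'] by auto
    with Z that show ?thesis unfolding type_mono_def by blast
  qed
  show ?case
  proof (rule ccontr)
    assume nle: "\<not> le c x"
    from R_step[OF P(1) Q(1) Rij] ne consider
      (B1) s where "s < ?r" "U (rep g) \<inter> L (w_at s) \<noteq> {}" "R s ?r'"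
    | (B2) b where "b \<in> blU (rep g)" "\<forall>s<?r. b \<in> U (w_at s) \<longrightarrow> R s ?r'"
    | (C1) s where "s < ?r'" "U (w_at s) \<inter> L (rep g') \<noteq> {}" "R ?r s"
    | (C2) a where "a \<in> blL (rep g')" "\<forall>s<?r'. a \<in> L (w_at s) \<longrightarrow> R ?r s"
      unfolding P(3) Q(3) by blast
    then show False
    proof cases
      case B1
      \<comment> \<open>A mediating element of \<open>U c\<close> is carried by \<open>Zs\<close>
        into \<open>L x\<close>, which would give \<open>le c x\<close>. The case \<open>C1\<close>
        is dual.\<close>
      have "L (w_at s) \<subseteq> L (w_at ?r')" using Zs[OF _ _ B1(3)] B1(1) by auto
      then show False using B1(2) nle mediate_le[of c x] Q(3) Uc Lx by auto
    next
      case C1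
      have "U (w_at s) \<subseteq> U (w_at ?r)" using Zs[OF _ _ C1(3)] C1(1) by auto
      then show False using C1(2) nle mediate_le[of c x] P(3) Uc Lx by auto
    next
      case B2
      \<comment> \<open>A component of \<open>c\<close> inherits the failure. Its type also occurs
        two rounds earlier with the same parity, and the induction hypothesis refutes it.\<close>
      then have "b \<in> blU c" using blU_cong[OF Uc] by simp
      from compU[OF this nle] obtain c' where c': "c' \<in> comps c" "b \<in> U c'" "\<not> le c' x" by blast
      have av: "avail (Suc h) c'" using avail_comps[OF c c'(1)] .
      from avail_type[OF this] obtain g2 where g2: "g2 \<le> h" "U c' = U (rep g2)" "L c' = L (rep g2)"
        unfolding less_Suc_eq_le by blast
      note P2 = pos_facts[OF hk(1) _ g2(1), of "i - 2"]
      have i2: "i - 2 < M" using ij by simp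
      have lt: "pos h (i - 2) g2 < ?r" using pos_less[of "i - 2" i g2 h g] ij g2(1) hk(1) by simp
      have "b \<in> U (w_at (pos h (i - 2) g2))" using P2(3)[OF i2] g2(2) c'(2) by simp
      with B2(2) lt have Rs: "R (pos h (i - 2) g2) ?r'" by blast
      have i2m: "(i - 2) mod 2 = par" using ij(3,5) mod_2_diff_2[of i] by simp
      have "(h, g2, k, g') \<in> W stable_round"
        by (rule W_memI[OF hk(1) g2(1) hk(2,4) i2 ij(2) _ _ i2m ij(6) Rs]) (use ij(3,4) in simp_all)
      then have "le c' x"
        using comps_sz[OF c'(1)] by (intro less.hyps[OF _ av x g2(2,3) Ux Lx]) simp_all
      with c' show False by simp
    next
      case C2
      then have "a \<in> blL x" using blL_cong[OF Lx] by simp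
      from compL[OF this nle] obtain x' where x': "x' \<in> comps x" "a \<in> L x'" "\<not> le c x'" by blast
      have av: "avail (Suc k) x'" using avail_comps[OF x x'(1)] .
      from avail_type[OF this] obtain g2 where g2: "g2 \<le> k" "U x' = U (rep g2)" "L x' = L (rep g2)"
        unfolding less_Suc_eq_le by blast
      note P2 = pos_facts[OF hk(2) _ g2(1), of "j - 2"]
      have j2: "j - 2 < M" using ij by simp
      have lt: "pos k (j - 2) g2 < ?r'" using pos_less[of "j - 2" j g2 k g'] ij g2(1) hk(2) by simp
      have "a \<in> L (w_at (pos k (j - 2) g2))" using P2(3)[OF j2] g2(3) x'(2) by simp
      with C2(2) lt have Rs: "R ?r (pos k (j - 2) g2)" by blast
      have j2m: "(j - 2) mod 2 = 1 - par" using ij(4,6) mod_2_diff_2[of j] by simp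
      have "(h, g, k, g2) \<in> W stable_round"
        by (rule W_memI[OF hk(1,3,2) g2(1) ij(1) j2 _ _ ij(5) j2m Rs]) (use ij(3,4) in simp_all)
      then have "le c x'"
        using comps_sz[OF x'(1)] by (intro less.hyps[OF _ c av Uc Lc g2(2,3)]) simp_all
      with x' show False by simp
    qed
  qed
qed

text \<open>The right-hand word ranges over all available words, while on the left only the
  representative of a position is known. The set \<open>X\<close> collects the meets that may still be
  used: passing to a word of minimal size above the meet \<open>a\<close> makes it impossible to use
  \<open>a\<close> a second time.\<close>

lemma late_right_sound:
  assumes Z: "type_mono (ph r) k" and r: "r < N" and k: "k < m"
  shows "finite X \<Longrightarrow> X \<subseteq> S \<Longrightarrow> avail (Suc k) x \<Longrightarrow> U x = U (rep g') \<Longrightarrow> L x = L (rep g') \<Longrightarrow> g' \<le> k \<Longrightarrow>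
    (\<And>a x'. a \<in> S - X \<Longrightarrow> avail (Suc k) x' \<Longrightarrow> a \<in> L x' \<Longrightarrow> sz x' < sz x \<Longrightarrow> le (w_at r) x') \<Longrightarrow>
    j < M \<Longrightarrow> j mod 2 = 1 - par \<Longrightarrow> 2 * stable_round + 4 * card X + 4 \<le> j \<Longrightarrow>
    r \<noteq> pos k j g' \<Longrightarrow> R r (pos k j g') \<Longrightarrow> le (w_at r) x"
proof (induction "card X" arbitrary: X x g' j rule: less_induct)
  case less
  note X = less.prems(1,2) and x = less.prems(3) and Ux = less.prems(4) and Lx = less.prems(5)
    and g' = less.prems(6) and lab = less.prems(7) and j = less.prems(8-10)
  note P = pos_facts[OF k j(1) g']
  let ?c = "w_at r" and ?r' = "pos k j g'"
  have Zs: "U (w_at s') \<subseteq> U (w_at s) \<and> L (w_at s) \<subseteq> L (w_at s')"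
    if "s \<le> r" "s' \<le> ?r'" "R s s'" for s s'
  proof -
    have "ph s \<le> ph r" "ph s' \<le> k" "s < N" "s' < N"
      using that r P(1,2) ph_mono[of s r] ph_mono[of s' ?r'] by auto
    with Z that show ?thesis unfolding type_mono_def by blast
  qed
  show ?case
  proof (rule ccontr)
    assume nle: "\<not> le ?c x"
    from R_step[OF r P(1) less.prems(12)] less.prems(11) consider
      (B1) s where "s < r" "U ?c \<inter> L (w_at s) \<noteq> {}" "R s ?r'"
    | (B2) b where "b \<in> blU ?c" "\<forall>s<r. b \<in> U (w_at s) \<longrightarrow> R s ?r'"
    | (C1) s where "s < ?r'" "U (w_at s) \<inter> L (rep g') \<noteq> {}" "R r s"
    | (C2) a where "a \<in> blL (rep g')" "\<forall>s<?r'. a \<in> L (w_at s) \<longrightarrow> R r s"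
      unfolding P(3) by blast
    then show False
    proof cases
      case B1
      have "L (w_at s) \<subseteq> L x" using Zs[OF _ _ B1(3)] B1(1) P(3) Lx by auto
      then show False using B1(2) nle mediate_le[of ?c x] by auto
    next
      case C1
      have "U (w_at s) \<subseteq> U ?c" using Zs[OF _ _ C1(3)] C1(1) by auto
      then show False using C1(2) nle mediate_le[of ?c x] Lx by auto
    next
      case B2
      \<comment> \<open>The components of a representative have types of an earlier phase. So the
        left side can be moved to a late round of that phase as well, where
        \<open>late_sound\<close> applies.\<close>
      from compU[OF B2(1) nle] obtain c where c: "c \<in> comps ?c" "b \<in> U c" "\<not> le c x" by blast
      have "idx r < m" using idx_le_ph[of r] ph_less[OF r] by simp
      from rep_comps[OF this c(1)] have av: "avail (ph r) c" using avail_mono idx_le_ph by blast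
      from avail_type[OF this] obtain g where g: "g < ph r" "U c = U (rep g)" "L c = L (rep g)"
        by auto
      define h where "h = ph r - 1"
      have h: "g \<le> h" "h < ph r" "h < m" "ph r = Suc h" using g(1) ph_less[OF r] by (auto simp: h_def)
      define i where "i = 2 * stable_round + par"
      have i: "i < M" "i mod 2 = par" "2 * stable_round \<le> i"
        using stable_round(1) M_large par by (auto simp: i_def)
      note Q = pos_facts[OF h(3) i(1) h(1)]
      have "b \<in> U (w_at (pos h i g))" using c(2) g(2) Q(3) by simp
      with B2(2) Q(5)[OF h(2)] have Rs: "R (pos h i g) ?r'" by blast
      have "(h, g, k, g') \<in> W stable_round"
        by (rule W_memI[OF h(3,1) k g' i(1) j(1) i(3) _ i(2) j(2) Rs]) (use j(3) in simp)
      moreover have "type_mono h k" using Z h(2) unfolding type_mono_def by (meson le_trans less_imp_le order.trans)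
      moreover have "avail (Suc h) c" using av h(4) by simp
      ultimately have "le c x"
        using late_sound x g Ux Lx by blast
      with c show False by simp
    next
      case C2
      then have a: "a \<in> blL x" using blL_cong[OF Lx] by simp
      from compL[OF this nle] obtain y where y: "y \<in> comps x" "a \<in> L y" "\<not> le ?c y" by blast
      have aS: "a \<in> S" using a blL_sub unfolding L_def by blast
      have avy: "avail (Suc k) y" using avail_comps[OF x y(1)] .
      \<comment> \<open>For meets outside \<open>X\<close>, \<open>lab\<close> already settles all
        available words above them that are smaller than \<open>x\<close>, such as
        \<open>y\<close>.\<close>
      have aX: "a \<in> X" using lab[of a y] avy y aS comps_sz[OF y(1)] by blast
      define x' where "x' = arg_min sz (\<lambda>x'. avail (Suc k) x' \<and> a \<in> L x' \<and> \<not> le ?c x')"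
      have x': "avail (Suc k) x'" "a \<in> L x'" "\<not> le ?c x'"
        and mn: "\<And>z. avail (Suc k) z \<Longrightarrow> a \<in> L z \<Longrightarrow> \<not> le ?c z \<Longrightarrow> sz x' \<le> sz z"
        using arg_min_nat_lemma[of "\<lambda>x'. avail (Suc k) x' \<and> a \<in> L x' \<and> \<not> le ?c x'" y sz] avy y
        unfolding x'_def by blast+
      have szx': "sz x' < sz x" using mn[OF avy y(2,3)] comps_sz[OF y(1)] by simp
      from avail_type[OF x'(1)] obtain g2 where g2: "g2 \<le> k" "U x' = U (rep g2)" "L x' = L (rep g2)"
        unfolding less_Suc_eq_le by blast
      have cX: "card (X - {a}) < card X" "Suc (card (X - {a})) = card X"
        using card_Suc_Diff1[OF X(1) aX] by simp_all
      \<comment> \<open>Two rounds back keep the parity; four are taken when two would land on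
        \<open>r\<close> itself. This is why each meet costs four rounds.\<close>
      define j2 where "j2 = (if r = pos k (j - 2) g2 then j - 4 else j - 2)"
      have jge: "8 \<le> j" using cX j(3) by simp
      have j2: "j2 < j" "j2 < M" "j2 mod 2 = 1 - par" "2 * stable_round + 4 * card (X - {a}) + 4 \<le> j2"
    proof -
        have "j2 = j - 4 \<or> j2 = j - 2" by (auto simp: j2_def)
        moreover have "(j - 4) mod 2 = j mod 2" "(j - 2) mod 2 = j mod 2"
          using jge mod_2_diff_2[of j] mod_2_diff_4[of j] by simp_all
        ultimately show "j2 mod 2 = 1 - par" using j(2) by metis
      qed (use jge j cX in \<open>auto simp: j2_def\<close>)
      have ne: "r \<noteq> pos k j2 g2"
      proof -
        have "pos k (j - 4) g2 < pos k (j - 2) g2" using jge g2(1) k by (intro pos_less) auto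
        then show ?thesis by (auto simp: j2_def)
      qed
      note Q = pos_facts[OF k j2(2) g2(1)]
      have "pos k j2 g2 < ?r'" using pos_less[OF j2(1)] g2(1) k by simp
      moreover have "a \<in> L (w_at (pos k j2 g2))" using Q(3) g2(3) x'(2) by simp
      ultimately have Rj: "R r (pos k j2 g2)" using C2(2) by blast
      have lab': "le ?c z" if "b \<in> S - (X - {a})" "avail (Suc k) z" "b \<in> L z" "sz z < sz x'" for b z
      proof (cases "b = a")
        case True then show ?thesis using mn[OF that(2)] that(3,4) by force
      next
        case False then show ?thesis using lab[of b z] that szx' by auto
      qed
      have "le ?c x'"
        by (rule less.hyps[OF cX(1) _ _ x'(1) g2(2,3,1) lab' j2(2,3,4) ne Rj]) (use X in auto)
      with x' show False by simp
    qed
  qed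
qed

text \<open>Mediation and blocked joins on the left lead to smaller positions, where the induction
  hypothesis applies. A blocked meet on the right is answered in a late round of the preceding phase
  by \<open>late_right_sound\<close>.\<close>

lemma type_mono_step:
  assumes r: "r < N" "r' < N" "R r r'"
    and IH: "\<And>t t'. t \<le> r \<Longrightarrow> t' \<le> r' \<Longrightarrow> t + t' < r + r' \<Longrightarrow> R t t' \<Longrightarrow> U (w_at t') \<subseteq> U (w_at t)"
    and Z: "0 < ph r' \<Longrightarrow> type_mono (ph r) (ph r' - 1)"
  shows "U (w_at r') \<subseteq> U (w_at r)"
proof (rule subsetI, rule ccontr)
  fix d assume d: "d \<in> U (w_at r')" "d \<notin> U (w_at r)"
  then have dS: "d \<in> S" "le (w_at r') (v d)" "\<not> le (w_at r) (v d)" by (auto simp: U_def)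
  from R_step[OF r] d consider
      (B1) s where "s < r" "U (w_at r) \<inter> L (w_at s) \<noteq> {}" "R s r'"
    | (B2) b where "b \<in> blU (w_at r)" "\<forall>s<r. b \<in> U (w_at s) \<longrightarrow> R s r'"
    | (C1) s where "s < r'" "U (w_at s) \<inter> L (w_at r') \<noteq> {}" "R r s"
    | (C2) a where "a \<in> blL (w_at r')" "\<forall>s<r'. a \<in> L (w_at s) \<longrightarrow> R r s"
    by blast
  then show False
  proof cases
    case B1
    then show False using IH[of s r'] le_U[OF mediate_le[OF B1(2)]] d by auto
  next
    case C1
    then show False using IH[of r s] le_U[OF mediate_le[OF C1(2)]] d by auto
  next
    case B2
    from compU[OF B2(1) dS(3)] obtain c where c: "c \<in> comps (w_at r)" "b \<in> U c" "\<not> le c (v d)" by blast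
    have "idx r < m" using idx_le_ph[of r] ph_less[OF r(1)] by simp
    from rep_comps[OF this c(1)] have av: "avail (ph r) c" using avail_mono idx_le_ph by blast
    from avail_type[OF this] obtain g where g: "g < ph r" "U c = U (rep g)" "L c = L (rep g)"
      by auto
    define h where "h = ph r - 1"
    have h: "g \<le> h" "h < ph r" "h < m" using g(1) ph_less[OF r(1)] by (auto simp: h_def)
    have "0 < M" using M_large by simp
    note Q = pos_facts[OF h(3) this h(1)]
    have "b \<in> U (w_at (pos h 0 g))" using c(2) g(2) Q(3) by simp
    with B2(2) Q(5)[OF h(2)] have "R (pos h 0 g) r'" by blast
    then have "U (w_at r') \<subseteq> U c" using IH[of "pos h 0 g" r'] Q(3,5) h(2) g(2) by auto
    then show False using d(1) c(3) by (auto simp: U_def)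
  next
    case C2
    have nle: "\<not> le (w_at r) (w_at r')" using dS le_trans by blast
    from compL[OF C2(1) nle] obtain x where x: "x \<in> comps (w_at r')" "a \<in> L x" "\<not> le (w_at r) x" by blast
    have "idx r' < m" using idx_le_ph[of r'] ph_less[OF r(2)] by simp
    from rep_comps[OF this x(1)] have av: "avail (ph r') x" using avail_mono idx_le_ph by blast
    from avail_type[OF this] obtain g where g: "g < ph r'" "U x = U (rep g)" "L x = L (rep g)"
      by auto
    define k where "k = ph r' - 1"
    have k: "g \<le> k" "k < ph r'" "k < m" "Suc k = ph r'" using g(1) ph_less[OF r(2)] by (auto simp: k_def)
    \<comment> \<open>Late enough to start with every meet still allowed: for \<open>X = S\<close>
      the assumption of \<open>late_right_sound\<close> on earlier meets is vacuous. Two more rounds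
      avoid \<open>r\<close>.\<close>
    define j where "j = (let j = 2 * stable_round + 4 * card S + 4 + (1 - par) in if r = pos k j g then j + 2 else j)"
    have j: "j < M" "j mod 2 = 1 - par" "2 * stable_round + 4 * card S + 4 \<le> j"
    proof -
      let ?q = "stable_round + 2 * card S + 2"
      have "(2 * q + (1 - par)) mod 2 = 1 - par" for q by simp
      moreover have "j = 2 * ?q + (1 - par) \<or> j = 2 * Suc ?q + (1 - par)"
        by (auto simp: j_def Let_def)
      ultimately show "j mod 2 = 1 - par" by metis
    qed (use stable_round(1) M_large par in \<open>auto simp: j_def Let_def\<close>)
    have ne: "r \<noteq> pos k j g"
    proof -
      let ?j = "2 * stable_round + 4 * card S + 4 + (1 - par)"
      have "pos k ?j g < pos k (?j + 2) g" using k by (intro pos_less) auto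
      then show ?thesis by (auto simp: j_def Let_def)
    qed
    note Q = pos_facts[OF k(3) j(1) k(1)]
    have "a \<in> L (w_at (pos k j g))" using x(2) g(3) Q(3) by simp
    with C2(2) Q(5)[OF k(2)] have Rj: "R r (pos k j g)" by blast
    have Zk: "type_mono (ph r) k" using Z g(1) by (simp add: k_def)
    have "avail (Suc k) x" using av k(4) by simp
    from late_right_sound[OF Zk r(1) k(3) fin subset_refl this g(2,3) k(1) _ j ne Rj]
    have "le (w_at r) x" by blast
    with x show False by simp
  qed
qed

text \<open>The outer induction on the phases supplies soundness with one phase less on either side,
  the inner one on the positions follows the moves. Inclusion of \<open>L\<close> is inclusion of
  \<open>U\<close> in the dual game.\<close>

lemma type_mono_all: "type_mono h k"
proof (induction "h + k" arbitrary: h k rule: less_induct)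
  case less
  interpret D: game "\<lambda>x y. le y x" v S blL blU comps sz avail rep m M L U ph idx pos
      "\<lambda>x y. R y x" "1 - par"
    by (unfold U_def L_def ph_def idx_def pos_def) (rule dual_game)
  have "t < N \<Longrightarrow> t' < N \<Longrightarrow> ph t \<le> h \<Longrightarrow> ph t' \<le> k \<Longrightarrow> R t t' \<Longrightarrow>
    U (w_at t') \<subseteq> U (w_at t) \<and> L (w_at t) \<subseteq> L (w_at t')" for t t'
  proof (induction "t + t'" arbitrary: t t' rule: less_induct)
    case inner: less
    have IH: "U (w_at s') \<subseteq> U (w_at s) \<and> L (w_at s) \<subseteq> L (w_at s')"
      if "s \<le> t" "s' \<le> t'" "s + s' < t + t'" "R s s'" for s s'
      by (rule inner.hyps) (use inner.prems that ph_mono[of s t] ph_mono[of s' t'] in linarith)+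
    have z1: "type_mono (ph t) (ph t' - 1)" if "0 < ph t'"
      by (rule less) (use inner.prems that in linarith)
    have z2: "type_mono (ph t - 1) (ph t')" if "0 < ph t"
      by (rule less) (use inner.prems that in linarith)
    then have z2': "D.type_mono (ph t') (ph t - 1)" if "0 < ph t"
      using that unfolding type_mono_def D.type_mono_def by blast
    have "U (w_at t') \<subseteq> U (w_at t)"
    proof (rule type_mono_step[OF inner.prems(1,2,5)])
      show "U (w_at s') \<subseteq> U (w_at s)" if "s \<le> t" "s' \<le> t'" "s + s' < t + t'" "R s s'" for s s'
        using IH[OF that] by simp
    qed (rule z1)
    moreover have "L (w_at t) \<subseteq> L (w_at t')"
    proof (rule D.type_mono_step[OF inner.prems(2,1,5)])
      show "L (w_at s') \<subseteq> L (w_at s)" if "s \<le> t'" "s' \<le> t" "s + s' < t' + t" "R s' s" for s s'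
        using IH[of s' s] that by simp
    qed (rule z2')
    ultimately show ?case by blast
  qed
  then show ?case unfolding type_mono_def by blast
qed

lemma R_imp_U_subset: "t < N \<Longrightarrow> t' < N \<Longrightarrow> R t t' \<Longrightarrow> U (w_at t') \<subseteq> U (w_at t)"
  using type_mono_all[of "ph t" "ph t'"] unfolding type_mono_def by blast

end

section \<open>Realising a sequence of types\<close>

primrec height_word :: "'a lat_word \<Rightarrow> nat" where
  "height_word (Gen x) = 0"
| "height_word (Sup_word s t) = Suc (max (height_word s) (height_word t))"
| "height_word (Inf_word s t) = Suc (max (height_word s) (height_word t))"

lemma height_join_list:
  "\<forall>w\<in>set ws. height_word w \<le> H \<Longrightarrow> height_word z \<le> H \<Longrightarrow>
    height_word (join_list ws z) \<le> H + length ws"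
  by (induction ws) auto

lemma height_meet_list:
  "\<forall>w\<in>set ws. height_word w \<le> H \<Longrightarrow> height_word z \<le> H \<Longrightarrow>
    height_word (meet_list ws z) \<le> H + length ws"
  by (induction ws) auto

lemma set_join_list:
  "set_lat_word (join_list ws z) = (\<Union>w\<in>set ws. set_lat_word w) \<union> set_lat_word z"
  by (induction ws) auto

lemma set_meet_list:
  "set_lat_word (meet_list ws z) = (\<Union>w\<in>set ws. set_lat_word w) \<union> set_lat_word z"
  by (induction ws) auto

definition jblocked :: "lat_term set \<Rightarrow> lat_term set" where
  "jblocked A = {b \<in> A. \<exists>q r. b = Join q r \<and> q \<notin> A \<and> r \<notin> A}"

definition mblocked :: "lat_term set \<Rightarrow> lat_term set" where
  "mblocked A = {a \<in> A. \<exists>q r. a = Meet q r \<and> q \<notin> A \<and> r \<notin> A}"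

text \<open>Whitman's condition for longer meets and joins: each use of the binary condition peels
  one entry off one of the lists.\<close>

lemma wle_meet_list_join_list:
  "wle (meet_list ws z) (join_list ws' z') \<Longrightarrow>
    (\<exists>w\<in>set ws. wle w (join_list ws' z')) \<or> wle z (join_list ws' z') \<or>
    (\<exists>w'\<in>set ws'. wle (meet_list ws z) w') \<or> wle (meet_list ws z) z'"
proof (induction "length ws + length ws'" arbitrary: ws ws' rule: less_induct)
  case less
  show ?case
  proof (cases ws)
    case Nil then show ?thesis using less.prems by simp
  next
    case ws: (Cons w ws1)
    show ?thesis
    proof (cases ws')
      case Nil then show ?thesis using less.prems by simp
    next
      case ws': (Cons w' ws1')
      let ?M = "meet_list ws1 z" and ?J = "join_list ws1' z'"
      from less.prems ws ws' consider "wle w (Sup_word w' ?J)" | "wle ?M (Sup_word w' ?J)"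
        | "wle (Inf_word w ?M) w'" | "wle (Inf_word w ?M) ?J" by auto
      then show ?thesis
      proof cases
        case 2
        with less.hyps[of ws1 ws'] ws ws' show ?thesis by (auto intro: wle_InfI2)
      next
        case 4
        with less.hyps[of ws ws1'] ws ws' show ?thesis by (auto intro: wle_SupI2)
      qed (use ws ws' in auto)
    qed
  qed
qed

text \<open>All elements constructed below lie between these two words. As a consequence, no such element lies below
  one of the fresh generators.\<close>

abbreviation (input) "botw \<equiv> Inf_word (Gen 0) (Gen (Suc 0))"
abbreviation (input) "topw \<equiv> Sup_word (Gen 0) (Gen (Suc 0))"

text \<open>Isolates what the construction demands of the types alone. \<open>blocked_both\<close>
  makes blocked meets and blocked joins of the same type compatible; see
  \<open>elt_meet\<close>.\<close>

locale scheme =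
  fixes uu ll :: "nat \<Rightarrow> lat_term set" and sl :: "lat_term list" and N :: nat
  assumes med_U: "s < N \<Longrightarrow> t < N \<Longrightarrow> uu s \<inter> ll t \<noteq> {} \<Longrightarrow> uu t \<subseteq> uu s"
    and med_L: "s < N \<Longrightarrow> t < N \<Longrightarrow> uu s \<inter> ll t \<noteq> {} \<Longrightarrow> ll s \<subseteq> ll t"
    and blocked_both: "t < N \<Longrightarrow> a \<in> mblocked (ll t) \<Longrightarrow> b \<in> jblocked (uu t) \<Longrightarrow>
      \<exists>s<t. a \<in> ll s \<and> b \<in> uu s"
    and blocked_L: "t < N \<Longrightarrow> a \<in> mblocked (ll t) \<Longrightarrow> \<exists>s<t. a \<in> ll s"
    and blocked_U: "t < N \<Longrightarrow> b \<in> jblocked (uu t) \<Longrightarrow> \<exists>s<t. b \<in> uu s"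
    and uu_sub: "t < N \<Longrightarrow> uu t \<subseteq> set sl" and ll_sub: "t < N \<Longrightarrow> ll t \<subseteq> set sl"
begin

text \<open>\<open>Gen (t + 2)\<close> is the fresh generator, as 0 and 1 are reserved for
  \<open>botw\<close> and \<open>topw\<close>. The later abbreviations are spelled out because the
  recursion runs through them.\<close>

fun elt :: "nat \<Rightarrow> nat lat_word" where
  "elt t = meet_list
    (join_list (Gen (t + 2) # map elt (filter (\<lambda>s. uu s \<inter> ll t \<noteq> {}) [0..<t]) @
       map (\<lambda>a. meet_list (map elt (filter (\<lambda>s. a \<in> ll s) [0..<t])) topw)
         (filter (\<lambda>a. a \<in> mblocked (ll t)) sl)) botw #
     map elt (filter (\<lambda>s. uu t \<inter> ll s \<noteq> {}) [0..<t]) @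
       map (\<lambda>b. join_list (map elt (filter (\<lambda>s. b \<in> uu s) [0..<t])) botw)
         (filter (\<lambda>b. b \<in> jblocked (uu t)) sl)) topw"

declare elt.simps [simp del]

definition upper_bd :: "nat \<Rightarrow> lat_term \<Rightarrow> nat lat_word" where
  "upper_bd t a = meet_list (map elt (filter (\<lambda>s. a \<in> ll s) [0..<t])) topw"

definition lower_bd :: "nat \<Rightarrow> lat_term \<Rightarrow> nat lat_word" where
  "lower_bd t b = join_list (map elt (filter (\<lambda>s. b \<in> uu s) [0..<t])) botw"

definition lows :: "nat \<Rightarrow> nat lat_word list" where
  "lows t = map elt (filter (\<lambda>s. uu s \<inter> ll t \<noteq> {}) [0..<t]) @
    map (upper_bd t) (filter (\<lambda>a. a \<in> mblocked (ll t)) sl)"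

definition ups :: "nat \<Rightarrow> nat lat_word list" where
  "ups t = map elt (filter (\<lambda>s. uu t \<inter> ll s \<noteq> {}) [0..<t]) @
    map (lower_bd t) (filter (\<lambda>b. b \<in> jblocked (uu t)) sl)"

definition plus :: "nat \<Rightarrow> nat lat_word" where
  "plus t = join_list (Gen (t + 2) # lows t) botw"

lemma elt: "elt t = meet_list (plus t # ups t) topw"
  unfolding elt.simps[of t] plus_def lows_def ups_def upper_bd_def lower_bd_def by simp

lemma mblocked_sl: "t < N \<Longrightarrow> mblocked (ll t) \<subseteq> set sl"
  using ll_sub unfolding mblocked_def by blast

lemma jblocked_sl: "t < N \<Longrightarrow> jblocked (uu t) \<subseteq> set sl"
  using uu_sub unfolding jblocked_def by blast

lemma set_lows: "t < N \<Longrightarrow>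
  set (lows t) = elt ` {s. s < t \<and> uu s \<inter> ll t \<noteq> {}} \<union> upper_bd t ` mblocked (ll t)"
  using mblocked_sl[of t] unfolding lows_def by auto

lemma set_ups: "t < N \<Longrightarrow>
  set (ups t) = elt ` {s. s < t \<and> uu t \<inter> ll s \<noteq> {}} \<union> lower_bd t ` jblocked (uu t)"
  using jblocked_sl[of t] unfolding ups_def by auto

lemma wle_upper_bd: "wle w (upper_bd t a) \<longleftrightarrow> (\<forall>s<t. a \<in> ll s \<longrightarrow> wle w (elt s)) \<and> wle w topw"
  unfolding upper_bd_def wle_meet_list by auto

lemma lower_bd_wle: "wle (lower_bd t b) w \<longleftrightarrow> (\<forall>s<t. b \<in> uu s \<longrightarrow> wle (elt s) w) \<and> wle botw w"
  unfolding lower_bd_def join_list_wle by auto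

lemma elt_lower_bd: "s < t \<Longrightarrow> b \<in> uu s \<Longrightarrow> wle (elt s) (lower_bd t b)"
  unfolding lower_bd_def by (intro wle_join_listI[of "elt s"]) auto

lemma elt_topw: "wle (elt t) topw"
  unfolding elt by (rule meet_list_base_wle) (rule wle_refl)

lemma wle_elt: "t < N \<Longrightarrow> wle w (elt t) \<longleftrightarrow> wle w (plus t) \<and>
  (\<forall>s<t. uu t \<inter> ll s \<noteq> {} \<longrightarrow> wle w (elt s)) \<and> (\<forall>b\<in>jblocked (uu t). wle w (lower_bd t b)) \<and> wle w topw"
  unfolding elt[of t] wle_meet_list by (auto simp: set_ups)

lemma botw_elt: "t < N \<Longrightarrow> wle botw (elt t)"
proof (induction t rule: less_induct)
  case (less t)
  show ?case unfolding wle_elt[OF less.prems]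
  proof (intro conjI allI impI ballI)
    fix s assume "s < t" "uu t \<inter> ll s \<noteq> {}"
    then show "wle botw (elt s)" using less by simp
  next
    show "wle botw (plus t)" unfolding plus_def by (rule wle_join_list_base) (rule wle_refl)
  next
    show "wle botw (lower_bd t b)" for b
      unfolding lower_bd_def by (rule wle_join_list_base) (rule wle_refl)
  qed simp
qed

text \<open>If \<open>s\<close> comes first, \<open>elt s\<close> is a joinand of
  \<open>plus t\<close>, and the inclusion of types puts it below every member of
  \<open>ups t\<close>. If \<open>t\<close> comes first, \<open>elt t\<close> is a factor of
  \<open>elt s\<close>.\<close>

lemma elt_mono: "s < N \<Longrightarrow> t < N \<Longrightarrow> uu s \<inter> ll t \<noteq> {} \<Longrightarrow> wle (elt s) (elt t)"
proof (induction "s + t" arbitrary: s t rule: less_induct)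
  case less
  note st = less.prems
  consider "s < t" | "s = t" | "t < s" by linarith
  then show ?case
  proof cases
    case 1
    have "wle (elt s) (plus t)" unfolding plus_def
      using 1 st by (intro wle_join_listI[of "elt s"]) (auto simp: set_lows)
    moreover have "wle (elt s) (elt s')" if "s' < t" "uu t \<inter> ll s' \<noteq> {}" for s'
    proof (rule less.hyps)
      show "uu s \<inter> ll s' \<noteq> {}" using med_U[OF st] that(2) by blast
    qed (use that st in auto)
    moreover have "wle (elt s) (lower_bd t b)" if "b \<in> jblocked (uu t)" for b
      using med_U[OF st] that 1 by (intro elt_lower_bd) (auto simp: jblocked_def)
    ultimately show ?thesis unfolding wle_elt[OF st(2)] using elt_topw by simp
  next
    case 3
    then have "elt t \<in> set (plus s # ups s)" using st by (auto simp: set_ups)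
    then show ?thesis unfolding elt[of s] by (rule meet_list_wleI) (rule wle_refl)
  qed simp
qed

text \<open>Unless the join is blocked, one of its summands mediates. If blocked,
  \<open>elt t\<close> lies below the join of all earlier elements of that kind, which induction on
  \<open>t\<close> bounds.\<close>

lemma elt_join:
  assumes "i < N" "j < N" "q \<in> ll i" "r \<in> ll j"
  shows "t < N \<Longrightarrow> Join q r \<in> uu t \<Longrightarrow> wle (elt t) (Sup_word (elt i) (elt j))"
proof (induction t rule: less_induct)
  case (less t)
  consider "q \<in> uu t" | "r \<in> uu t" | "Join q r \<in> jblocked (uu t)"
    using less.prems unfolding jblocked_def by blast
  then show ?case
  proof cases
    case 1
    then have "wle (elt t) (elt i)" using elt_mono[of t i] less.prems assms by blast
    then show ?thesis by (rule wle_SupI1)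
  next
    case 2
    then have "wle (elt t) (elt j)" using elt_mono[of t j] less.prems assms by blast
    then show ?thesis by (rule wle_SupI2)
  next
    case 3
    then have "lower_bd t (Join q r) \<in> set (plus t # ups t)" using less.prems by (auto simp: set_ups)
    moreover have "wle (lower_bd t (Join q r)) (Sup_word (elt i) (elt j))"
      using less botw_elt[OF assms(1)] by (auto simp: lower_bd_wle intro: wle_SupI1)
    ultimately show ?thesis unfolding elt[of t] by (rule meet_list_wleI)
  qed
qed

text \<open>No mirror image of \<open>elt_join\<close>, since \<open>elt\<close> is outermost a meet
  and all of \<open>ups t\<close> must be checked too. Against a blocked join, an earlier position
  belonging to both blocked elements interpolates.\<close>

lemma elt_meet:
  assumes "i < N" "j < N" "q \<in> uu i" "r \<in> uu j"
  shows "t < N \<Longrightarrow> Meet q r \<in> ll t \<Longrightarrow> wle (Inf_word (elt i) (elt j)) (elt t)"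
proof (induction t rule: less_induct)
  case (less t)
  consider "q \<in> ll t" | "r \<in> ll t" | "Meet q r \<in> mblocked (ll t)"
    using less.prems unfolding mblocked_def by blast
  then show ?case
  proof cases
    case 1
    then have "wle (elt i) (elt t)" using elt_mono[of i t] less.prems assms by blast
    then show ?thesis by (rule wle_InfI1)
  next
    case 2
    then have "wle (elt j) (elt t)" using elt_mono[of j t] less.prems assms by blast
    then show ?thesis by (rule wle_InfI2)
  next
    case 3
    let ?w = "Inf_word (elt i) (elt j)"
    have top: "wle ?w topw" using elt_topw by (rule wle_InfI1)
    have "wle ?w (upper_bd t (Meet q r))" using less top by (auto simp: wle_upper_bd)
    moreover have "upper_bd t (Meet q r) \<in> set (Gen (t + 2) # lows t)"
      using 3 less.prems by (auto simp: set_lows)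
    ultimately have "wle ?w (plus t)" unfolding plus_def by (intro wle_join_listI)
    moreover have "wle ?w (elt s)" if "s < t" "uu t \<inter> ll s \<noteq> {}" for s
      using less that med_L[of t s] by auto
    moreover have "wle ?w (lower_bd t b)" if b: "b \<in> jblocked (uu t)" for b
    proof -
      obtain s where s: "s < t" "Meet q r \<in> ll s" "b \<in> uu s"
        using blocked_both[OF less.prems(1) 3 b] by blast
      then have "wle ?w (elt s)" using less by simp
      from wle_trans[OF this elt_lower_bd[OF s(1,3)]] show ?thesis .
    qed
    ultimately show ?thesis unfolding wle_elt[OF less.prems(1)] using top by blast
  qed
qed

section \<open>Separation by homomorphisms into the two-element lattice\<close>

lemma eval_join_list [simp]:
  "eval_word h (join_list ws z) \<longleftrightarrow> (\<exists>w\<in>set ws. eval_word h w) \<or> eval_word h z"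
  for h :: "'x \<Rightarrow> bool"
  by (induction ws) auto

lemma eval_meet_list [simp]:
  "eval_word h (meet_list ws z) \<longleftrightarrow> (\<forall>w\<in>set ws. eval_word h w) \<and> eval_word h z"
  for h :: "'x \<Rightarrow> bool"
  by (induction ws) auto

text \<open>With a single fresh generator true, \<open>topw\<close> is false, and so is everything
  below it, in particular each \<open>elt t\<close> and \<open>upper_bd\<close>.\<close>

lemma eval_gen_only:
  "\<not> eval_word (\<lambda>x. x = r + 2) (elt t)"
  "r \<noteq> t \<Longrightarrow> t < N \<Longrightarrow> \<not> eval_word (\<lambda>x. x = r + 2) (plus t)"
proof -
  show *: "\<not> eval_word (\<lambda>x. x = r + 2) (elt t)" for t by (simp add: elt)
  show "r \<noteq> t \<Longrightarrow> t < N \<Longrightarrow> \<not> eval_word (\<lambda>x. x = r + 2) (plus t)"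
    by (auto simp: plus_def set_lows *[simplified] upper_bd_def)
qed

lemma eval_all_but_gen: "t < N \<Longrightarrow> eval_word (\<lambda>x. x \<noteq> r + 2) (elt t)"
  by (induction t rule: less_induct) (auto simp: elt plus_def set_ups lower_bd_def)

text \<open>Now \<open>topw\<close> is true and \<open>botw\<close> false, so an empty meet in
  \<open>upper_bd\<close> would evaluate to true; \<open>blocked_L\<close> excludes that.\<close>

lemma eval_0_only: "t < N \<Longrightarrow> \<not> eval_word (\<lambda>x. x = 0) (elt t) \<and> \<not> eval_word (\<lambda>x. x = 0) (plus t)"
proof (induction t rule: less_induct)
  case (less t)
  have "\<not> eval_word (\<lambda>x. x = 0) (upper_bd t a)" if "a \<in> mblocked (ll t)" for a
    using blocked_L[OF less.prems that] less by (force simp: upper_bd_def)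
  then have "\<not> eval_word (\<lambda>x. x = 0) (plus t)"
    using less by (auto simp: plus_def set_lows)
  then show ?case by (simp add: elt)
qed

lemma eval_all_but_0: "t < N \<Longrightarrow> eval_word (\<lambda>x. x \<noteq> 0) (elt t)"
proof (induction t rule: less_induct)
  case (less t)
  have "eval_word (\<lambda>x. x \<noteq> 0) (lower_bd t b)" if "b \<in> jblocked (uu t)" for b
    using blocked_U[OF less.prems that] less by (force simp: lower_bd_def)
  then show ?case using less by (auto simp: elt plus_def set_ups)
qed

text \<open>Whitman's condition for a meet below a join. The four evaluations exclude the
  alternatives with fresh generators or bounds; those left are the rules of \<open>game\<close>,
  after weakening \<open>elt s\<close> on the right to \<open>plus s\<close>.\<close>

lemma elt_wle_plus:
  assumes r: "r < N" "r' < N" and R: "wle (elt r) (plus r')"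
  shows "r = r' \<or> (\<exists>s<r. uu r \<inter> ll s \<noteq> {} \<and> wle (elt s) (plus r'))
    \<or> (\<exists>b\<in>jblocked (uu r). \<forall>s<r. b \<in> uu s \<longrightarrow> wle (elt s) (plus r'))
    \<or> (\<exists>s<r'. uu s \<inter> ll r' \<noteq> {} \<and> wle (elt r) (plus s))
    \<or> (\<exists>a\<in>mblocked (ll r'). \<forall>s<r'. a \<in> ll s \<longrightarrow> wle (elt r) (plus s))"
proof (cases "r = r'")
  case False
  have elt_plus: "wle w (plus s)" if "wle w (elt s)" for w s
    using that unfolding elt[of s] wle_meet_list by simp
  have "\<not> wle (plus r) (plus r')"
    using wle_sound[of "plus r" "plus r'" "\<lambda>x. x = r + 2"] eval_gen_only(2)[OF False r(2)]
    by (auto simp: plus_def[of r])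
  moreover have "\<not> wle topw (plus r')"
    using wle_sound[of topw "plus r'" "\<lambda>x. x = 0"] eval_0_only[OF r(2)] by auto
  moreover have "\<not> wle (elt r) (Gen (r' + 2))"
    using wle_sound[of "elt r" "Gen (r' + 2)" "\<lambda>x. x \<noteq> r' + 2"] eval_all_but_gen[OF r(1)] by auto
  moreover have "\<not> wle (elt r) botw"
    using wle_sound[of "elt r" botw "\<lambda>x. x \<noteq> 0"] eval_all_but_0[OF r(1)] by auto
  moreover from wle_meet_list_join_list[of "plus r # ups r" topw "Gen (r' + 2) # lows r'" botw]
  have "(\<exists>w\<in>set (plus r # ups r). wle w (plus r')) \<or> wle topw (plus r') \<or>
      (\<exists>w\<in>set (Gen (r' + 2) # lows r'). wle (elt r) w) \<or> wle (elt r) botw"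
    using R unfolding elt[symmetric] plus_def[symmetric] by blast
  ultimately consider w where "w \<in> set (ups r)" "wle w (plus r')"
    | w where "w \<in> set (lows r')" "wle (elt r) w" by auto
  then show ?thesis
  proof cases
    case w: 1
    from w(1) consider s where "s < r" "uu r \<inter> ll s \<noteq> {}" "w = elt s"
      | b where "b \<in> jblocked (uu r)" "w = lower_bd r b" unfolding set_ups[OF r(1)] by blast
    then show ?thesis
    proof cases
      case 1 then show ?thesis using w(2) by blast
    next
      case 2
      then have "\<forall>s<r. b \<in> uu s \<longrightarrow> wle (elt s) (plus r')" using w(2) by (simp add: lower_bd_wle)
      with 2(1) show ?thesis by blast
    qed
  next
    case w: 2
    from w(1) consider s where "s < r'" "uu s \<inter> ll r' \<noteq> {}" "w = elt s"
      | a where "a \<in> mblocked (ll r')" "w = upper_bd r' a" unfolding set_lows[OF r(2)] by blast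
    then show ?thesis
    proof cases
      case 1 then show ?thesis using elt_plus w(2) by blast
    next
      case 2
      then have "\<forall>s<r'. a \<in> ll s \<longrightarrow> wle (elt r) (plus s)"
        using elt_plus w(2) by (simp add: wle_upper_bd)
      with 2(1) show ?thesis by blast
    qed
  qed
qed simp

text \<open>Height rather than size, because it does not grow when earlier elements are reused: a
  new element adds only the lengths of its lists.\<close>

lemma height_elt:
  "height_word (elt t) \<le> 1 + Suc t * (3 * t + 2 * length sl + 2)"
proof (induction t rule: less_induct)
  case (less t)
  let ?H = "1 + t * (3 * t + 2 * length sl + 2)"
  have e: "height_word (elt s) \<le> ?H" if "s < t" for s
  proof -
    have "Suc s * (3 * s + 2 * length sl + 2) \<le> t * (3 * t + 2 * length sl + 2)"
      using that by (intro mult_le_mono) auto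
    with less[OF that] show ?thesis by linarith
  qed
  have len: "length (filter P [0..<t]) \<le> t" for P
    using length_filter_le[of P "[0..<t]"] by simp
  have b: "height_word (lower_bd t b) \<le> ?H + t" "height_word (upper_bd t b) \<le> ?H + t" for b
    unfolding lower_bd_def upper_bd_def
    by (rule order.trans[OF height_join_list[of _ ?H]] order.trans[OF height_meet_list[of _ ?H]];
        use e len in force)+
  have l: "length (lows t) \<le> t + length sl" "length (ups t) \<le> t + length sl"
    unfolding lows_def ups_def using len length_filter_le by (auto intro!: add_mono)
  have m: "height_word w \<le> ?H + t" if "w \<in> set (lows t) \<union> set (ups t)" for w
    using that b e unfolding lows_def ups_def by (auto intro: le_add1 le_trans[OF e])
  have "height_word (plus t) \<le> (?H + t) + length (Gen (t + 2) # lows t)"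
    unfolding plus_def by (rule height_join_list) (use m in auto)
  then have p: "height_word (plus t) \<le> ?H + t + Suc (t + length sl)" using l by simp
  have "height_word (elt t) \<le> (?H + t + Suc (t + length sl)) + length (plus t # ups t)"
    unfolding elt by (rule height_meet_list) (use m p in \<open>auto intro: le_trans[OF m]\<close>)
  also have "\<dots> \<le> 1 + Suc t * (3 * t + 2 * length sl + 2)" using l by simp
  finally show ?case .
qed

lemma gens_elt: "set_lat_word (elt t) \<subseteq> {..t + 2}"
proof (induction t rule: less_induct)
  case (less t)
  then have "set_lat_word (elt s) \<subseteq> {..t + 2}" if "s < t" for s using that by fastforce
  then show ?case
    unfolding elt[of t] plus_def lows_def ups_def lower_bd_def upper_bd_def
    by (auto simp: set_join_list set_meet_list subset_eq)
qed

end

section \<open>Solutions of bounded size\<close>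

primrec subterms :: "lat_term \<Rightarrow> lat_term set" where
  "subterms (Var n) = {Var n}"
| "subterms (Join s t) = insert (Join s t) (subterms s \<union> subterms t)"
| "subterms (Meet s t) = insert (Meet s t) (subterms s \<union> subterms t)"

lemma subterms_self [simp]: "s \<in> subterms s"
  by (cases s) auto

lemma subterms_trans: "t \<in> subterms s \<Longrightarrow> subterms t \<subseteq> subterms s"
  by (induction s) auto

lemma finite_subterms [simp]: "finite (subterms s)"
  by (induction s) auto

primrec subwords :: "'a lat_word \<Rightarrow> 'a lat_word set" where
  "subwords (Gen x) = {Gen x}"
| "subwords (Sup_word s t) = insert (Sup_word s t) (subwords s \<union> subwords t)"
| "subwords (Inf_word s t) = insert (Inf_word s t) (subwords s \<union> subwords t)"

primrec comps :: "'a lat_word \<Rightarrow> 'a lat_word set" where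
  "comps (Gen x) = {}"
| "comps (Sup_word s t) = {s, t}"
| "comps (Inf_word s t) = {s, t}"

lemma subwords_self [simp]: "w \<in> subwords w"
  by (cases w) auto

lemma subwords_size: "u \<in> subwords w \<Longrightarrow> size u \<le> size w"
  by (induction w) auto

lemma comps_size: "c \<in> comps w \<Longrightarrow> size c < size w"
  by (cases w) auto

lemma comps_subwords: "c \<in> comps w \<Longrightarrow> subwords c \<subseteq> subwords w"
  by (cases w) auto

text \<open>Takes a longest list of distinct types whose representatives have only subwords of
  earlier types. A word of minimal size among those of missing type could be appended, so none is
  missing.\<close>

lemma ex_representatives:
  fixes tp :: "'w \<Rightarrow> 't" and sub :: "'w \<Rightarrow> 'w set" and sz :: "'w \<Rightarrow> nat"
  assumes fin: "finite A" and ran: "\<And>w. tp w \<in> A" and sz: "\<And>u w. u \<in> sub w \<Longrightarrow> sz u < sz w"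
  shows "\<exists>m rep. m \<le> card A \<and> (\<forall>w. \<exists>g<m. tp w = tp (rep g)) \<and>
    (\<forall>g<m. \<forall>u\<in>sub (rep g). \<exists>g'<g. tp u = tp (rep g'))"
proof -
  define P where "P k \<longleftrightarrow> (\<exists>rep. inj_on (\<lambda>g. tp (rep g)) {..<k} \<and>
    (\<forall>g<k. \<forall>u\<in>sub (rep g). \<exists>g'<g. tp u = tp (rep g')))" for k :: nat
  have "P 0" by (simp add: P_def)
  moreover have bd: "k \<le> card A" if Pk: "P k" for k
  proof -
    obtain rep where "inj_on (\<lambda>g. tp (rep g)) {..<k}" using Pk P_def by blast
    from card_inj_on_le[OF this _ fin] ran show ?thesis by auto
  qed
  ultimately obtain k where k: "P k" "\<And>l. P l \<Longrightarrow> l \<le> k"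
    using ex_has_greatest_nat[of P 0 id "Suc (card A)"] by (auto simp: less_Suc_eq_le)
  then obtain rep where rep: "inj_on (\<lambda>g. tp (rep g)) {..<k}"
      "\<forall>g<k. \<forall>u\<in>sub (rep g). \<exists>g'<g. tp u = tp (rep g')" unfolding P_def by blast
  have "\<exists>g<k. tp w = tp (rep g)" for w
  proof (rule ccontr)
    let ?Q = "\<lambda>w. \<not> (\<exists>g<k. tp w = tp (rep g))"
    assume "?Q w"
    then obtain w' where w': "?Q w'" "\<And>u. ?Q u \<Longrightarrow> sz w' \<le> sz u"
      using arg_min_nat_lemma[of ?Q w sz] by blast
    let ?rep = "rep(k := w')"
    have "inj_on (\<lambda>g. tp (?rep g)) {..<Suc k}"
      using rep(1) w'(1) by (auto simp: inj_on_def less_Suc_eq)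
    moreover have "\<exists>g'<g. tp u = tp (?rep g')" if g: "g < Suc k" and u: "u \<in> sub (?rep g)" for g u
    proof (cases "g = k")
      case True
      then have "sz u < sz w'" using u sz by auto
      then have "\<exists>g<k. tp u = tp (rep g)" using w'(2)[of u] not_le by blast
      then show ?thesis using True by auto
    next
      case False
      then have "g < k" using g by simp
      then obtain g' where "g' < g" "tp u = tp (rep g')" using rep(2) u False by auto
      then show ?thesis using \<open>g < k\<close> by (intro exI[of _ g']) auto
    qed
    ultimately have "P (Suc k)" unfolding P_def by blast
    from k(2)[OF this] show False by simp
  qed
  with rep(2) bd[OF k(1)] show ?thesis by blast
qed

text \<open>Bounds \<open>m * (M * m)\<close>, the length of the sequence of types, by way of
  \<open>m \<le> 4 ^ n\<close>.\<close>

definition pos_bd :: "nat \<Rightarrow> nat" where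
  "pos_bd n = 4 ^ n * ((2 * (4 ^ n) ^ 4 + 4 * n + 12) * 4 ^ n)"

definition height_bd :: "nat \<Rightarrow> nat" where
  "height_bd n = 1 + Suc (pos_bd n) * (3 * pos_bd n + 2 * n + 2)"

text \<open>A word below a join but below neither joinand is no generator. If it is a join, both
  components stay below \<open>b\<close>; if it is a meet, Whitman's condition provides one that
  does.\<close>

lemma jblocked_comp:
  assumes SJ: "\<And>q r. Join q r \<in> S \<Longrightarrow> q \<in> S \<and> r \<in> S"
    and SM: "\<And>q r. Meet q r \<in> S \<Longrightarrow> q \<in> S \<and> r \<in> S"
    and b: "b \<in> jblocked {p \<in> S. wle w (inst \<theta> p)}"
  shows "\<not> wle w x \<Longrightarrow> \<exists>c\<in>comps w. b \<in> {p \<in> S. wle c (inst \<theta> p)} \<and> \<not> wle c x"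
    and "\<exists>c\<in>comps w. b \<in> {p \<in> S. wle c (inst \<theta> p)}"
proof -
  obtain q r where b': "b = Join q r" "b \<in> S" "wle w (inst \<theta> b)"
      "q \<notin> {p \<in> S. wle w (inst \<theta> p)}" "r \<notin> {p \<in> S. wle w (inst \<theta> p)}"
    using b unfolding jblocked_def by blast
  then have qr: "\<not> wle w (inst \<theta> q)" "\<not> wle w (inst \<theta> r)" using SJ[of q r] by auto
  show "\<not> wle w x \<Longrightarrow> \<exists>c\<in>comps w. b \<in> {p \<in> S. wle c (inst \<theta> p)} \<and> \<not> wle c x"
    using b' qr by (cases w) (auto intro: wle_InfI1 wle_InfI2)
  show "\<exists>c\<in>comps w. b \<in> {p \<in> S. wle c (inst \<theta> p)}"
    using b' qr by (cases w) auto
qed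

text \<open>For the last claim: if \<open>w\<close> is a join, both components are below
  \<open>b\<close> and Whitman's condition puts one above \<open>a\<close>; if \<open>w\<close> is a
  meet, the roles are exchanged.\<close>

lemma mblocked_comp:
  assumes SJ: "\<And>q r. Join q r \<in> S \<Longrightarrow> q \<in> S \<and> r \<in> S"
    and SM: "\<And>q r. Meet q r \<in> S \<Longrightarrow> q \<in> S \<and> r \<in> S"
    and a: "a \<in> mblocked {p \<in> S. wle (inst \<theta> p) w}"
  shows "\<not> wle x w \<Longrightarrow> \<exists>c\<in>comps w. a \<in> {p \<in> S. wle (inst \<theta> p) c} \<and> \<not> wle x c"
    and "\<exists>c\<in>comps w. a \<in> {p \<in> S. wle (inst \<theta> p) c}"
    and "b \<in> jblocked {p \<in> S. wle w (inst \<theta> p)} \<Longrightarrow>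
      \<exists>c\<in>comps w. a \<in> {p \<in> S. wle (inst \<theta> p) c} \<and> b \<in> {p \<in> S. wle c (inst \<theta> p)}"
proof -
  obtain q r where a': "a = Meet q r" "a \<in> S" "wle (inst \<theta> a) w"
      "q \<notin> {p \<in> S. wle (inst \<theta> p) w}" "r \<notin> {p \<in> S. wle (inst \<theta> p) w}"
    using a unfolding mblocked_def by blast
  then have qr: "\<not> wle (inst \<theta> q) w" "\<not> wle (inst \<theta> r) w" using SM[of q r] by auto
  show "\<not> wle x w \<Longrightarrow> \<exists>c\<in>comps w. a \<in> {p \<in> S. wle (inst \<theta> p) c} \<and> \<not> wle x c"
    using a' qr by (cases w) (auto intro: wle_SupI1 wle_SupI2)
  show "\<exists>c\<in>comps w. a \<in> {p \<in> S. wle (inst \<theta> p) c}"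
    using a' qr by (cases w) auto
  assume "b \<in> jblocked {p \<in> S. wle w (inst \<theta> p)}"
  then obtain q' r' where b': "b = Join q' r'" "b \<in> S" "wle w (inst \<theta> b)"
      "q' \<notin> {p \<in> S. wle w (inst \<theta> p)}" "r' \<notin> {p \<in> S. wle w (inst \<theta> p)}"
    unfolding jblocked_def by blast
  then have qr': "\<not> wle w (inst \<theta> q')" "\<not> wle w (inst \<theta> r')"
    using SJ[of q' r'] by auto
  show "\<exists>c\<in>comps w. a \<in> {p \<in> S. wle (inst \<theta> p) c} \<and> b \<in> {p \<in> S. wle c (inst \<theta> p)}"
    using a' qr b' qr' by (cases w) auto
qed

text \<open>\<open>scheme\<close> preserves the order of the old solution and its joins and meets,
  and \<open>game\<close> excludes new inequalities. The bounds depend only on the length of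
  \<open>sl\<close>.\<close>

lemma bounded_solution:
  fixes \<theta> :: "nat \<Rightarrow> 'x lat_word"
  assumes SJ: "\<And>q r. Join q r \<in> set sl \<Longrightarrow> q \<in> set sl \<and> r \<in> set sl"
    and SM: "\<And>q r. Meet q r \<in> set sl \<Longrightarrow> q \<in> set sl \<and> r \<in> set sl"
  shows "\<exists>\<theta>' :: nat \<Rightarrow> nat lat_word.
    (\<forall>s\<in>set sl. \<forall>t\<in>set sl. wle (inst \<theta>' s) (inst \<theta>' t) \<longleftrightarrow> wle (inst \<theta> s) (inst \<theta> t)) \<and>
    (\<forall>n. height_word (\<theta>' n) \<le> height_bd (length sl) \<and> set_lat_word (\<theta>' n) \<subseteq> {..pos_bd (length sl) + 2})"
proof -
  define U where "U w = {p \<in> set sl. wle w (inst \<theta> p)}" for w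
  define L where "L w = {p \<in> set sl. wle (inst \<theta> p) w}" for w
  let ?tp = "\<lambda>w. (U w, L w)"
  let ?A = "Pow (set sl) \<times> Pow (set sl)"
  have "u \<in> (\<Union>c\<in>comps w. subwords c) \<Longrightarrow> size u < size w" for u w :: "'x lat_word"
    using subwords_size comps_size by (metis UN_E le_less_trans)
  from ex_representatives[of ?A ?tp "\<lambda>w. \<Union>c\<in>comps w. subwords c" size, OF _ _ this]
  obtain m rep where m: "m \<le> card ?A" and cover: "\<And>w. \<exists>g<m. U w = U (rep g) \<and> L w = L (rep g)"
    and reps: "\<And>g c u. g < m \<Longrightarrow> c \<in> comps (rep g) \<Longrightarrow> u \<in> subwords c \<Longrightarrow>
      \<exists>g'<g. U u = U (rep g') \<and> L u = L (rep g')"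
    by (auto simp: U_def L_def) blast
  define avail where "avail h w \<longleftrightarrow> (\<forall>u\<in>subwords w. \<exists>g<h. U u = U (rep g) \<and> L u = L (rep g))" for h w
  define M where "M = 2 * m ^ 4 + 4 * length sl + 12"
  define ph where "ph t = t div (M * m)" for t
  define idx where "idx t = min (t mod m) (t div (M * m))" for t
  define pos where "pos h i g = h * (M * m) + i * m + g" for h i g
  have jb: "b \<in> jblocked (U w) \<Longrightarrow> \<not> wle w x \<Longrightarrow> \<exists>c\<in>comps w. b \<in> U c \<and> \<not> wle c x"
    "b \<in> jblocked (U w) \<Longrightarrow> \<exists>c\<in>comps w. b \<in> U c" for b w x
    using jblocked_comp[OF SJ SM] unfolding U_def by blast+
  have mb: "a \<in> mblocked (L w) \<Longrightarrow> \<not> wle x w \<Longrightarrow> \<exists>c\<in>comps w. a \<in> L c \<and> \<not> wle x c"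
    "a \<in> mblocked (L w) \<Longrightarrow> \<exists>c\<in>comps w. a \<in> L c"
    "a \<in> mblocked (L w) \<Longrightarrow> b \<in> jblocked (U w) \<Longrightarrow> \<exists>c\<in>comps w. a \<in> L c \<and> b \<in> U c" for a b w x
    using mblocked_comp[OF SJ SM] unfolding U_def L_def by blast+
  have U_eq: "U \<equiv> \<lambda>w. {p \<in> set sl. wle w (inst \<theta> p)}"
    and L_eq: "L \<equiv> \<lambda>w. {p \<in> set sl. wle (inst \<theta> p) w}"
    and ph_eq: "ph \<equiv> \<lambda>t. t div (M * m)"
    and idx_eq: "idx \<equiv> \<lambda>t. min (t mod m) (t div (M * m))"
    and pos_eq: "pos \<equiv> \<lambda>h i g. h * (M * m) + i * m + g"
    by (simp_all add: U_def L_def ph_def idx_def pos_def fun_eq_iff atomize_eq)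
  have frame: "frame wle (inst \<theta>) (set sl) (\<lambda>w. jblocked (U w)) (\<lambda>w. mblocked (L w)) comps size
    avail rep m M"
  proof (rule frame.intro, goal_cases)
    case 1 show ?case by simp
  next
    case (2 x y z) then show ?case by (rule wle_trans)
  next
    case (3 w) show ?case by (auto simp: jblocked_def U_def)
  next
    case (4 w) show ?case by (auto simp: mblocked_def L_def)
  next
    case (5 w w') then show ?case by (simp add: U_def)
  next
    case (6 w w') then show ?case by (simp add: L_def)
  next
    case (7 b w x) from jb(1)[OF this] show ?case by (simp add: U_def)
  next
    case (8 a w x) from mb(1)[OF this] show ?case by (simp add: L_def)
  next
    case (9 c w) then show ?case by (rule comps_size)
  next
    case (10 h w)
    then have "\<exists>g<h. U w = U (rep g) \<and> L w = L (rep g)" unfolding avail_def by simp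
    then show ?case unfolding U_def L_def .
  next
    case (11 h w c) then show ?case using comps_subwords unfolding avail_def by blast
  next
    case (12 h w h') then show ?case unfolding avail_def by (meson less_le_trans)
  next
    case (13 g c) then show ?case using reps unfolding avail_def by blast
  next
    case 14 show ?case using card_length[of sl] by (simp add: M_def)
  qed
  interpret F: frame wle "inst \<theta>" "set sl" "\<lambda>w. jblocked (U w)" "\<lambda>w. mblocked (L w)" comps size
    avail rep m M U L ph idx pos
    using frame unfolding U_eq L_eq ph_eq idx_eq pos_eq .
  \<comment> \<open>The type of a component has a smaller number, hence occurs already in round 0 of
    the preceding phase.\<close>
  have earlier: "\<exists>s<t. U (rep (idx s)) = U c \<and> L (rep (idx s)) = L c"
    if t: "t < m * (M * m)" and c: "c \<in> comps (rep (idx t))" for t c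
  proof -
    have "idx t < m" using F.idx_le_ph[of t] F.ph_less[OF t] by simp
    from F.rep_comps[OF this c] F.avail_type obtain g
      where g: "g < idx t" "U c = U (rep g)" "L c = L (rep g)" by blast
    then have "ph t - 1 < m" "0 < M" "g \<le> ph t - 1" "ph t - 1 < ph t"
      using F.idx_le_ph[of t] F.ph_less[OF t] by (auto simp: M_def)
    from F.pos_facts[OF this(1-3)] this(4) g show ?thesis
      by (intro exI[of _ "pos (ph t - 1) 0 g"]) simp
  qed
  interpret Sc: scheme "\<lambda>t. U (rep (idx t))" "\<lambda>t. L (rep (idx t))" sl "m * (M * m)"
  proof (unfold_locales, goal_cases)
    case (1 s t) then show ?case using F.le_U[OF F.mediate_le] by blast
  next
    case (2 s t) then show ?case using F.le_L[OF F.mediate_le] by blast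
  next
    case (3 t a b)
    obtain c where c: "c \<in> comps (rep (idx t))" "a \<in> L c" "b \<in> U c" using mb(3)[OF 3(2,3)] by blast
    from earlier[OF 3(1) c(1)] c show ?case by blast
  next
    case (4 t a)
    obtain c where c: "c \<in> comps (rep (idx t))" "a \<in> L c" using mb(2)[OF 4(2)] by blast
    from earlier[OF 4(1) c(1)] c show ?case by blast
  next
    case (5 t b)
    obtain c where c: "c \<in> comps (rep (idx t))" "b \<in> U c" using jb(2)[OF 5(2)] by blast
    from earlier[OF 5(1) c(1)] c show ?case by blast
  qed (auto simp: U_def L_def)
  let ?R = "\<lambda>r r'. wle (Sc.elt r) (Sc.plus r')"
  have game: "game wle (inst \<theta>) (set sl) (\<lambda>w. jblocked (U w)) (\<lambda>w. mblocked (L w)) comps size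
    avail rep m M ?R 0"
  proof (rule game.intro[OF frame], rule game_axioms.intro)
    show "(0::nat) < 2" by simp
  next
    fix r r' assume "r < m * (M * m)" "r' < m * (M * m)" "?R r r'"
    from Sc.elt_wle_plus[OF this] show "r = r' \<or>
      (\<exists>s<r. {p \<in> set sl. wle (rep (min (r mod m) (r div (M * m)))) (inst \<theta> p)} \<inter>
        {p \<in> set sl. wle (inst \<theta> p) (rep (min (s mod m) (s div (M * m))))} \<noteq> {} \<and> ?R s r') \<or>
      (\<exists>b\<in>jblocked (U (rep (min (r mod m) (r div (M * m))))).
        \<forall>s<r. b \<in> {p \<in> set sl. wle (rep (min (s mod m) (s div (M * m)))) (inst \<theta> p)} \<longrightarrow> ?R s r') \<or>
      (\<exists>s<r'. {p \<in> set sl. wle (rep (min (s mod m) (s div (M * m)))) (inst \<theta> p)} \<inter>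
        {p \<in> set sl. wle (inst \<theta> p) (rep (min (r' mod m) (r' div (M * m))))} \<noteq> {} \<and> ?R r s) \<or>
      (\<exists>a\<in>mblocked (L (rep (min (r' mod m) (r' div (M * m))))).
        \<forall>s<r'. a \<in> {p \<in> set sl. wle (inst \<theta> p) (rep (min (s mod m) (s div (M * m))))} \<longrightarrow> ?R r s)"
      unfolding idx_def U_def L_def .
  qed
  interpret G: game wle "inst \<theta>" "set sl" "\<lambda>w. jblocked (U w)" "\<lambda>w. mblocked (L w)" comps size
    avail rep m M U L ph idx pos ?R 0
    using game unfolding U_eq L_eq ph_eq idx_eq pos_eq .
  define gi where "gi p = (SOME g. g < m \<and> U (inst \<theta> p) = U (rep g) \<and> L (inst \<theta> p) = L (rep g))" for p
  have gi: "gi p < m" "U (inst \<theta> p) = U (rep (gi p))" "L (inst \<theta> p) = L (rep (gi p))" for p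
    using someI_ex[OF cover[of "inst \<theta> p"]] unfolding gi_def by blast+
  \<comment> \<open>The last phase admits every type number below \<open>m\<close>.\<close>
  define at where "at p = pos (m - 1) 0 (gi p)" for p
  have atN: "at p < m * (M * m)" and at_idx: "idx (at p) = gi p" for p
    using F.pos_facts[of "m - 1" 0 "gi p"] gi(1)[of p] by (auto simp: at_def M_def)
  have at: "U (rep (idx (at p))) = U (inst \<theta> p)" "L (rep (idx (at p))) = L (inst \<theta> p)" for p
    using gi[of p] at_idx[of p] by simp_all
  have selfU: "p \<in> U (inst \<theta> p)" and selfL: "p \<in> L (inst \<theta> p)" if "p \<in> set sl" for p
    using that by (auto simp: U_def L_def)
  have mono: "wle (Sc.elt (at s)) (Sc.elt (at t))"
    if "s \<in> set sl" "t \<in> set sl" "wle (inst \<theta> s) (inst \<theta> t)" for s t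
  proof (rule Sc.elt_mono[OF atN atN])
    show "U (rep (idx (at s))) \<inter> L (rep (idx (at t))) \<noteq> {}"
      unfolding at using that selfL[of t] by (auto simp: U_def)
  qed
  \<comment> \<open>\<open>Gen 0\<close> is a default for variables outside \<open>sl\<close>,
    within the same bounds.\<close>
  define \<theta>' where "\<theta>' n = (if Var n \<in> set sl then Sc.elt (at (Var n)) else Gen 0)" for n
  have key: "s \<in> set sl \<Longrightarrow> wle (inst \<theta>' s) (Sc.elt (at s)) \<and> wle (Sc.elt (at s)) (inst \<theta>' s)" for s
  proof (induction s)
    case (Var n) then show ?case by (simp add: \<theta>'_def)
  next
    case (Join q r)
    have qr: "q \<in> set sl" "r \<in> set sl" using SJ[OF Join.prems] by auto
    from Join.IH qr have k: "wle (inst \<theta>' q) (Sc.elt (at q))" "wle (Sc.elt (at q)) (inst \<theta>' q)"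
      "wle (inst \<theta>' r) (Sc.elt (at r))" "wle (Sc.elt (at r)) (inst \<theta>' r)" by blast+
    have mo: "wle (Sc.elt (at q)) (Sc.elt (at (Join q r)))" "wle (Sc.elt (at r)) (Sc.elt (at (Join q r)))"
      by (rule mono[OF _ Join.prems], (rule qr), simp add: wle_SupI1 wle_SupI2)+
    have 1: "wle (inst \<theta>' (Join q r)) (Sc.elt (at (Join q r)))"
      using wle_trans[OF k(1) mo(1)] wle_trans[OF k(3) mo(2)] by simp
    have 2: "wle (Sc.elt (at (Join q r))) (Sup_word (Sc.elt (at q)) (Sc.elt (at r)))"
      by (rule Sc.elt_join[of _ _ q r, OF atN atN _ _ atN])
        (simp_all only: at selfU[OF Join.prems] selfL[OF qr(1)] selfL[OF qr(2)])
    have "wle (Sup_word (Sc.elt (at q)) (Sc.elt (at r))) (inst \<theta>' (Join q r))"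
      using k by (simp add: wle_SupI1 wle_SupI2)
    from wle_trans[OF 2 this] 1 show ?case by blast
  next
    case (Meet q r)
    have qr: "q \<in> set sl" "r \<in> set sl" using SM[OF Meet.prems] by auto
    from Meet.IH qr have k: "wle (inst \<theta>' q) (Sc.elt (at q))" "wle (Sc.elt (at q)) (inst \<theta>' q)"
      "wle (inst \<theta>' r) (Sc.elt (at r))" "wle (Sc.elt (at r)) (inst \<theta>' r)" by blast+
    have mo: "wle (Sc.elt (at (Meet q r))) (Sc.elt (at q))" "wle (Sc.elt (at (Meet q r))) (Sc.elt (at r))"
      by (rule mono[OF Meet.prems], (rule qr), simp add: wle_InfI1 wle_InfI2)+
    have 1: "wle (Sc.elt (at (Meet q r))) (inst \<theta>' (Meet q r))"
      using wle_trans[OF mo(1) k(2)] wle_trans[OF mo(2) k(4)] by simp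
    have 2: "wle (Inf_word (Sc.elt (at q)) (Sc.elt (at r))) (Sc.elt (at (Meet q r)))"
      by (rule Sc.elt_meet[of _ _ q r, OF atN atN _ _ atN])
        (simp_all only: at selfL[OF Meet.prems] selfU[OF qr(1)] selfU[OF qr(2)])
    have "wle (inst \<theta>' (Meet q r)) (Inf_word (Sc.elt (at q)) (Sc.elt (at r)))"
      using k by (simp add: wle_InfI1 wle_InfI2)
    from wle_trans[OF this 2] 1 show ?case by blast
  qed
  have sep: "wle (inst \<theta> s) (inst \<theta> t)"
    if st: "s \<in> set sl" "t \<in> set sl" and le: "wle (Sc.elt (at s)) (Sc.elt (at t))" for s t
  proof -
    \<comment> \<open>\<open>plus\<close> is a factor of \<open>elt\<close>, so an inequality
      between new elements is a position of the game.\<close>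
    have "?R (at s) (at t)" using le unfolding Sc.elt[of "at t"] by simp
    from G.R_imp_U_subset[OF atN atN this] have "t \<in> U (inst \<theta> s)" using selfU[OF st(2)] by (auto simp: at)
    then show ?thesis by (simp add: U_def)
  qed
  have iff: "wle (inst \<theta>' s) (inst \<theta>' t) \<longleftrightarrow> wle (inst \<theta> s) (inst \<theta> t)"
    if st: "s \<in> set sl" "t \<in> set sl" for s t
  proof
    assume le: "wle (inst \<theta>' s) (inst \<theta>' t)"
    have "wle (Sc.elt (at s)) (inst \<theta>' s)" "wle (inst \<theta>' t) (Sc.elt (at t))" using key st by auto
    from wle_trans[OF wle_trans[OF this(1) le] this(2)] show "wle (inst \<theta> s) (inst \<theta> t)"
      by (rule sep[OF st])
  next
    assume le: "wle (inst \<theta> s) (inst \<theta> t)"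
    have "wle (inst \<theta>' s) (Sc.elt (at s))" "wle (Sc.elt (at t)) (inst \<theta>' t)" using key st by auto
    from wle_trans[OF wle_trans[OF this(1) mono[OF st le]] this(2)]
    show "wle (inst \<theta>' s) (inst \<theta>' t)" .
  qed
  let ?n = "length sl"
  have "card ?A = 2 ^ card (set sl) * 2 ^ card (set sl)" by (simp add: card_Pow card_cartesian_product)
  also have "\<dots> = 4 ^ card (set sl)" by (simp flip: power_mult_distrib)
  also have "\<dots> \<le> 4 ^ ?n" using card_length[of sl] by simp
  finally have m4: "m \<le> 4 ^ ?n" using m by simp
  then have "M \<le> 2 * (4 ^ ?n) ^ 4 + 4 * ?n + 12" unfolding M_def by (simp add: power_mono)
  then have Nbd: "m * (M * m) \<le> pos_bd ?n" unfolding pos_bd_def using m4 by (intro mult_le_mono)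
  have "height_word (\<theta>' n) \<le> height_bd ?n \<and> set_lat_word (\<theta>' n) \<subseteq> {..pos_bd ?n + 2}" for n
  proof -
    have lt: "at (Var n) < pos_bd ?n" using atN[of "Var n"] Nbd by simp
    have "Suc (at (Var n)) * (3 * at (Var n) + 2 * ?n + 2) \<le> Suc (pos_bd ?n) * (3 * pos_bd ?n + 2 * ?n + 2)"
      using lt by (intro mult_le_mono) auto
    then have "height_word (Sc.elt (at (Var n))) \<le> height_bd ?n"
      using Sc.height_elt[of "at (Var n)"] unfolding height_bd_def by linarith
    moreover have "set_lat_word (Sc.elt (at (Var n))) \<subseteq> {..pos_bd ?n + 2}"
      using Sc.gens_elt[of "at (Var n)"] lt by fastforce
    ultimately show ?thesis by (simp add: \<theta>'_def)
  qed
  with iff show ?thesis by blast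
qed

section \<open>Recursive functions\<close>

text \<open>Closes \<open>total_recursive\<close> under agreement on lists of length
  \<open>n\<close>, so that values elsewhere never matter.\<close>

definition recf :: "nat \<Rightarrow> (nat list \<Rightarrow> nat) \<Rightarrow> bool" where
  "recf n F \<longleftrightarrow> (\<exists>f. total_recursive n f \<and> (\<forall>xs. length xs = n \<longrightarrow> f xs = F xs))"

lemma recf_cong:
  assumes "recf n F" "\<And>xs. length xs = n \<Longrightarrow> F xs = G xs"
  shows "recf n G"
  using assms unfolding recf_def by metis

lemma recf_proj: "i < n \<Longrightarrow> recf n (\<lambda>xs. xs ! i)"
  unfolding recf_def using total_recursive.proj by blast

lemma recf_compose:
  assumes f: "recf (length gs) f" and gs: "\<forall>g\<in>set gs. recf n g"
  shows "recf n (\<lambda>xs. f (map (\<lambda>g. g xs) gs))"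
proof -
  obtain f' where f': "total_recursive (length gs) f'" "\<forall>xs. length xs = length gs \<longrightarrow> f' xs = f xs"
    using f recf_def by auto
  have "\<exists>gs'. length gs' = length gs \<and> (\<forall>g'\<in>set gs'. total_recursive n g') \<and>
      (\<forall>xs. length xs = n \<longrightarrow> map (\<lambda>g. g xs) gs' = map (\<lambda>g. g xs) gs)"
    using gs
  proof (induction gs)
    case (Cons g gs)
    then obtain gs' where gs': "length gs' = length gs" "\<forall>g'\<in>set gs'. total_recursive n g'"
      "\<forall>xs. length xs = n \<longrightarrow> map (\<lambda>g. g xs) gs' = map (\<lambda>g. g xs) gs" by auto
    obtain g' where g': "total_recursive n g'" "\<forall>xs. length xs = n \<longrightarrow> g' xs = g xs"
      using Cons.prems unfolding recf_def by auto
    show ?case by (rule exI[of _ "g' # gs'"]) (use gs' g' in simp)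
  qed simp
  then obtain gs' where gs': "length gs' = length gs" "\<forall>g'\<in>set gs'. total_recursive n g'"
    "\<forall>xs. length xs = n \<longrightarrow> map (\<lambda>g. g xs) gs' = map (\<lambda>g. g xs) gs" by blast
  have "total_recursive n (\<lambda>xs. f' (map (\<lambda>g. g xs) gs'))"
    by (rule total_recursive.comp) (use f' gs' in simp_all)
  moreover have "f' (map (\<lambda>g. g xs) gs') = f (map (\<lambda>g. g xs) gs)" if "length xs = n" for xs
    using f'(2) gs'(3) that by simp
  ultimately show ?thesis unfolding recf_def by blast
qed

lemma recf_comp1:
  assumes "recf 1 (\<lambda>xs. f (xs ! 0))" "recf n g"
  shows "recf n (\<lambda>xs. f (g xs))"
  using recf_compose[of "[g]" "\<lambda>xs. f (xs ! 0)" n] assms by simp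

lemma recf_comp2:
  assumes "recf 2 (\<lambda>xs. f (xs ! 0) (xs ! 1))" "recf n g" "recf n h"
  shows "recf n (\<lambda>xs. f (g xs) (h xs))"
  using recf_compose[of "[g, h]" "\<lambda>xs. f (xs ! 0) (xs ! 1)" n] assms by (simp add: numeral_2_eq_2)

lemma recf_comp3:
  assumes "recf 3 (\<lambda>xs. f (xs ! 0) (xs ! 1) (xs ! 2))" "recf n g" "recf n h" "recf n k"
  shows "recf n (\<lambda>xs. f (g xs) (h xs) (k xs))"
  using recf_compose[of "[g, h, k]" "\<lambda>xs. f (xs ! 0) (xs ! 1) (xs ! 2)" n] assms
  by (simp add: numeral_3_eq_3 numeral_2_eq_2)

lemma recf_prim_rec:
  assumes a: "recf 1 (\<lambda>xs. a (xs ! 0))" and g: "recf 3 (\<lambda>xs. g (xs ! 0) (xs ! 1) (xs ! 2))"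
    and F: "\<And>y. F 0 y = a y" "\<And>x y. F (Suc x) y = g x (F x y) y"
  shows "recf 2 (\<lambda>xs. F (xs ! 0) (xs ! 1))"
proof -
  obtain a' where a': "total_recursive 1 a'" "\<forall>xs. length xs = 1 \<longrightarrow> a' xs = a (xs ! 0)"
    using a recf_def by auto
  obtain g' where g': "total_recursive 3 g'" "\<forall>xs. length xs = 3 \<longrightarrow> g' xs = g (xs ! 0) (xs ! 1) (xs ! 2)"
    using g recf_def by auto
  have "total_recursive (Suc 1) (\<lambda>xs. rec_nat (a' (tl xs)) (\<lambda>k r. g' (k # r # tl xs)) (hd xs))"
    by (rule total_recursive.prim_rec) (use a' g' in \<open>simp_all add: numeral_3_eq_3\<close>)
  moreover have "rec_nat (a' [y]) (\<lambda>k r. g' (k # r # [y])) x = F x y" for x y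
    by (induction x) (use a'(2) g'(2) F in \<open>simp_all add: numeral_2_eq_2\<close>)
  then have "rec_nat (a' (tl xs)) (\<lambda>k r. g' (k # r # tl xs)) (hd xs) = F (xs ! 0) (xs ! 1)"
    if "length xs = 2" for xs
    using that by (auto simp: numeral_2_eq_2 length_Suc_conv)
  ultimately show ?thesis unfolding recf_def by (auto simp: numeral_2_eq_2)
qed

lemma recf_Least:
  assumes f: "recf (Suc n) f" and ex: "\<And>xs. length xs = n \<Longrightarrow> \<exists>k. f (k # xs) = 0"
  shows "recf n (\<lambda>xs. LEAST k. f (k # xs) = 0)"
proof -
  obtain f' where f': "total_recursive (Suc n) f'" "\<forall>xs. length xs = Suc n \<longrightarrow> f' xs = f xs"
    using f recf_def by auto
  have "total_recursive n (\<lambda>xs. LEAST k. f' (k # xs) = 0)"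
    by (rule total_recursive.minim) (use f' ex in simp_all)
  moreover have "(LEAST k. f' (k # xs) = 0) = (LEAST k. f (k # xs) = 0)" if "length xs = n" for xs
    using f'(2) that by simp
  ultimately show ?thesis unfolding recf_def by blast
qed

section \<open>Arithmetic functions\<close>

named_theorems recs

lemma recf_Suc [recs]: "recf n g \<Longrightarrow> recf n (\<lambda>xs. Suc (g xs))"
  by (rule recf_comp1[of Suc]) (auto simp: recf_def intro: total_recursive.succ[unfolded One_nat_def])

lemma recf_const [recs]: "recf n (\<lambda>_. c)"
proof (induction c)
  case 0
  show ?case unfolding recf_def using total_recursive.zero by blast
qed (rule recf_Suc)

lemma recf_nth [recs]:
  "recf (Suc n) (\<lambda>xs. xs ! 0)" "recf 2 (\<lambda>xs. xs ! 0)" "recf 2 (\<lambda>xs. xs ! 1)" "recf 2 (\<lambda>xs. xs ! Suc 0)"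
  "recf 1 (\<lambda>xs. xs ! 0)"
  "recf 3 (\<lambda>xs. xs ! 0)" "recf 3 (\<lambda>xs. xs ! 1)" "recf 3 (\<lambda>xs. xs ! Suc 0)" "recf 3 (\<lambda>xs. xs ! 2)"
  by (rule recf_proj, simp)+

lemma recf_add [recs]:
  assumes "recf n g" "recf n h" shows "recf n (\<lambda>xs. g xs + h xs)"
  by (rule recf_comp2[OF recf_prim_rec[of "\<lambda>y. y" "\<lambda>x r y. Suc r"] assms]) (auto intro!: recs)

lemma recf_pred: "recf 1 (\<lambda>xs. xs ! 0 - 1)"
proof -
  have "recf 2 (\<lambda>xs. (\<lambda>x y. x - 1) (xs ! 0) (xs ! 1))"
    by (rule recf_prim_rec[of "\<lambda>y. 0" "\<lambda>x r y. x"]) (auto intro!: recs)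
  from recf_comp2[OF this recf_nth(5) recf_nth(5)] show ?thesis .
qed

lemma recf_diff [recs]:
  assumes "recf n g" "recf n h" shows "recf n (\<lambda>xs. g xs - h xs)"
proof -
  have "recf 2 (\<lambda>xs. (\<lambda>x y. y - x) (xs ! 0) (xs ! 1))"
    by (rule recf_prim_rec[of "\<lambda>y. y" "\<lambda>x r y. r - 1"])
      (auto intro!: recs recf_comp1[of "\<lambda>x. x - 1"] recf_pred simp del: One_nat_def)
  from recf_comp2[OF this assms(2,1)] show ?thesis .
qed

lemma recf_mult [recs]:
  assumes "recf n g" "recf n h" shows "recf n (\<lambda>xs. g xs * h xs)"
proof -
  have "recf 2 (\<lambda>xs. (\<lambda>x y. x * y) (xs ! 0) (xs ! 1))"
    by (rule recf_prim_rec[of "\<lambda>y. 0" "\<lambda>x r y. y + r"]) (auto intro!: recs)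
  from recf_comp2[OF this assms] show ?thesis .
qed

lemma recf_power [recs]:
  assumes "recf n g" "recf n h" shows "recf n (\<lambda>xs. g xs ^ h xs)"
proof -
  have "recf 2 (\<lambda>xs. (\<lambda>x y. y ^ x) (xs ! 0) (xs ! 1))"
    by (rule recf_prim_rec[of "\<lambda>y. 1" "\<lambda>x r y. y * r"]) (auto intro!: recs)
  from recf_comp2[OF this assms(2,1)] show ?thesis .
qed

section \<open>Decidable predicates and bounded search\<close>

abbreviation recp :: "nat \<Rightarrow> (nat list \<Rightarrow> bool) \<Rightarrow> bool" where
  "recp n P \<equiv> recf n (\<lambda>xs. of_bool (P xs))"

lemma recp_eq_0: "recf n g \<Longrightarrow> recp n (\<lambda>xs. g xs = 0)"
  by (rule recf_cong[of n "\<lambda>xs. 1 - g xs"]) (auto intro!: recs)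

lemma recp_le [recs]: "recf n g \<Longrightarrow> recf n h \<Longrightarrow> recp n (\<lambda>xs. g xs \<le> h xs)"
  using recp_eq_0[of n "\<lambda>xs. g xs - h xs"] by (auto intro!: recs)

lemma recp_not [recs]: "recp n P \<Longrightarrow> recp n (\<lambda>xs. \<not> P xs)"
  by (rule recf_cong[of n "\<lambda>xs. 1 - of_bool (P xs)"]) (auto intro!: recs)

lemma recp_conj [recs]: "recp n P \<Longrightarrow> recp n Q \<Longrightarrow> recp n (\<lambda>xs. P xs \<and> Q xs)"
  by (rule recf_cong[of n "\<lambda>xs. of_bool (P xs) * of_bool (Q xs)"]) (auto intro!: recf_mult)

lemma recp_disj [recs]: "recp n P \<Longrightarrow> recp n Q \<Longrightarrow> recp n (\<lambda>xs. P xs \<or> Q xs)"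
  using recp_not[OF recp_conj[OF recp_not recp_not], of n P Q] by simp

lemma recp_imp [recs]:
  assumes "recp n P" "recp n Q" shows "recp n (\<lambda>xs. P xs \<longrightarrow> Q xs)"
proof -
  have "recp n (\<lambda>xs. \<not> P xs \<or> Q xs)" by (intro recp_disj recp_not assms)
  then show ?thesis by (simp only: imp_conv_disj)
qed

lemma recp_eq [recs]:
  assumes "recf n g" "recf n h" shows "recp n (\<lambda>xs. g xs = h xs)"
proof -
  have "recp n (\<lambda>xs. g xs \<le> h xs \<and> h xs \<le> g xs)" by (intro recp_conj recp_le assms)
  then show ?thesis by (simp only: order_eq_iff)
qed

lemma recf_if [recs]:
  assumes "recp n P" "recf n g" "recf n h"
  shows "recf n (\<lambda>xs. if P xs then g xs else h xs)"
  by (rule recf_cong[OF recf_add[OF recf_mult[OF assms(1,2)] recf_mult[OF recp_not[OF assms(1)] assms(3)]]])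
    auto

text \<open>Primitive recursion on the bound, carrying the truth value obtained so far.\<close>

lemma recp_ex_less:
  assumes P: "recp 2 (\<lambda>xs. P (xs ! 0) (xs ! 1))" and g: "recf n g" and h: "recf n h"
  shows "recp n (\<lambda>xs. \<exists>z<g xs. P z (h xs))"
proof -
  have "recf 2 (\<lambda>xs. (\<lambda>x y. of_bool (\<exists>z<x. P z y)) (xs ! 0) (xs ! 1))"
  proof (rule recf_prim_rec)
    show "recf 1 (\<lambda>xs. (\<lambda>_. 0) (xs ! 0))" by (auto intro!: recs)
    have "recf 3 (\<lambda>xs. of_bool (P (xs ! 0) (xs ! 2)))"
      by (rule recf_comp2[of "\<lambda>x y. of_bool (P x y)", OF P]) (auto intro!: recs)
    then have "recf 3 (\<lambda>xs. of_bool (xs ! 1 = 1 \<or> P (xs ! 0) (xs ! 2)))"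
      by (intro recp_disj recp_eq recf_nth recf_const)
    then show "recf 3 (\<lambda>xs. (\<lambda>x r y. of_bool (r = 1 \<or> P x y)) (xs ! 0) (xs ! 1) (xs ! 2))" .
  qed (auto simp: less_Suc_eq)
  from recf_comp2[OF this g h] show ?thesis .
qed

section \<open>Cantor pairing\<close>

definition pe :: "nat \<Rightarrow> nat \<Rightarrow> nat" where "pe a b = prod_encode (a, b)"
definition pfst :: "nat \<Rightarrow> nat" where "pfst z = fst (prod_decode z)"
definition psnd :: "nat \<Rightarrow> nat" where "psnd z = snd (prod_decode z)"

lemma pfst_pe [simp]: "pfst (pe a b) = a" and psnd_pe [simp]: "psnd (pe a b) = b"
  by (simp_all add: pe_def pfst_def psnd_def)

lemma pe_decode: "pe (pfst z) (psnd z) = z"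
  by (simp add: pe_def pfst_def psnd_def)

lemma pe_eq_iff [simp]: "pe a b = pe c d \<longleftrightarrow> a = c \<and> b = d"
  by (simp add: pe_def prod_encode_eq)

lemma le_pe: "a \<le> pe a b" "b \<le> pe a b"
  by (simp_all add: pe_def le_prod_encode_1 le_prod_encode_2)

lemma triangle_mono: "a \<le> b \<Longrightarrow> triangle a \<le> triangle b"
  by (induction rule: dec_induct) simp_all

lemma pe_mono: "a \<le> a' \<Longrightarrow> b \<le> b' \<Longrightarrow> pe a b \<le> pe a' b'"
  by (simp add: pe_def prod_encode_def add_mono triangle_mono)

lemma pe_less: "a \<le> a' \<Longrightarrow> b \<le> b' \<Longrightarrow> a < a' \<or> b < b' \<Longrightarrow> pe a b < pe a' b'"
  using pe_mono[of a a' b b'] by (auto simp: le_less)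

lemma less_pe: "0 < a \<Longrightarrow> b < pe a b"
  using pe_less[of 0 a b b] le_pe(2)[of b 0] by simp

lemma recf_triangle [recs]:
  assumes "recf n g" shows "recf n (\<lambda>xs. triangle (g xs))"
proof -
  have "recf 2 (\<lambda>xs. (\<lambda>x y. triangle x) (xs ! 0) (xs ! 1))"
    by (rule recf_prim_rec[of "\<lambda>y. 0" "\<lambda>x r y. r + Suc x"]) (auto intro!: recs)
  from recf_comp2[OF this assms assms] show ?thesis .
qed

lemma recf_pe [recs]: "recf n g \<Longrightarrow> recf n h \<Longrightarrow> recf n (\<lambda>xs. pe (g xs) (h xs))"
  unfolding pe_def prod_encode_def by (auto intro!: recs)

text \<open>Finds the diagonal \<open>a + b\<close> on which \<open>pe a b\<close> lies.
  Minimization does the search; the projections are then differences.\<close>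

definition triangle_root :: "nat \<Rightarrow> nat" where
  "triangle_root z = (LEAST s. z < triangle (Suc s))"

lemma triangle_root_pe: "triangle_root (pe a b) = a + b"
  unfolding triangle_root_def
proof (rule Least_equality)
  show "pe a b < triangle (Suc (a + b))" by (simp add: pe_def prod_encode_def)
next
  fix s assume s: "pe a b < triangle (Suc s)"
  show "a + b \<le> s"
  proof (rule ccontr)
    assume "\<not> a + b \<le> s"
    then have "triangle (Suc s) \<le> triangle (a + b)" by (intro triangle_mono) simp
    with s show False by (simp add: pe_def prod_encode_def)
  qed
qed

lemma pfst_eq: "pfst z = z - triangle (triangle_root z)"
  and psnd_eq: "psnd z = triangle_root z - pfst z"
proof -
  obtain a b where z: "z = pe a b" using pe_decode by metis
  show "pfst z = z - triangle (triangle_root z)"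
    unfolding z triangle_root_pe pfst_pe by (simp add: pe_def prod_encode_def)
  show "psnd z = triangle_root z - pfst z" unfolding z triangle_root_pe by simp
qed

lemma recf_triangle_root [recs]:
  assumes "recf n g" shows "recf n (\<lambda>xs. triangle_root (g xs))"
proof -
  have "\<exists>k. of_bool (triangle (Suc k) \<le> (z::nat)) = (0::nat)" for z
    by (rule exI[of _ z]) simp
  then have "recf 1 (\<lambda>xs. LEAST k. of_bool (triangle (Suc ((k # xs) ! 0)) \<le> (k # xs) ! 1) = (0::nat))"
    by (intro recf_Least) (auto intro!: recs simp: numeral_2_eq_2[symmetric])
  then have "recf 1 (\<lambda>xs. triangle_root (xs ! 0))"
    by (simp add: triangle_root_def not_le)
  from recf_comp1[OF this assms] show ?thesis .
qed

lemma recf_pfst [recs]: "recf n g \<Longrightarrow> recf n (\<lambda>xs. pfst (g xs))"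
  unfolding pfst_eq by (auto intro!: recs)

lemma recf_psnd [recs]: "recf n g \<Longrightarrow> recf n (\<lambda>xs. psnd (g xs))"
  unfolding psnd_eq by (auto intro!: recs)

section \<open>Course-of-values recursion\<close>

primrec hist :: "(nat \<Rightarrow> nat) \<Rightarrow> nat \<Rightarrow> nat" where
  "hist f 0 = 0"
| "hist f (Suc x) = pe (f x) (hist f x)"

text \<open>A history is a nest of pairs with the latest value outermost; dropping
  \<open>x - Suc y\<close> pairs brings the value at \<open>y\<close> to the front.\<close>

definition look :: "nat \<Rightarrow> nat \<Rightarrow> nat \<Rightarrow> nat" where
  "look x h y = pfst ((psnd ^^ (x - Suc y)) h)"

lemma look_hist: "y < x \<Longrightarrow> look x (hist f x) y = f y"
proof -
  assume "y < x"
  have "(psnd ^^ d) (hist f (y + Suc d)) = hist f (Suc y)" for d y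
    by (induction d) (simp_all add: funpow_Suc_right del: funpow.simps)
  from this[of "x - Suc y" y] \<open>y < x\<close> show ?thesis by (simp add: look_def)
qed

lemma recf_look [recs]:
  assumes "recf n x" "recf n h" "recf n y" shows "recf n (\<lambda>xs. look (x xs) (h xs) (y xs))"
proof -
  have "recf 2 (\<lambda>xs. (\<lambda>d h. (psnd ^^ d) h) (xs ! 0) (xs ! 1))"
    by (rule recf_prim_rec[of "\<lambda>y. y" "\<lambda>x r y. psnd r"]) (auto intro!: recs)
  then have "recf n (\<lambda>xs. (psnd ^^ (x xs - Suc (y xs))) (h xs))"
    by (rule recf_comp2) (use assms in \<open>auto intro!: recs\<close>)
  then show ?thesis unfolding look_def by (rule recf_pfst)
qed

text \<open>Course-of-values recursion: the functional receives the argument, the coded list of all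
  earlier values and a parameter.\<close>

fun cov_hist :: "(nat \<Rightarrow> nat \<Rightarrow> nat \<Rightarrow> nat) \<Rightarrow> nat \<Rightarrow> nat \<Rightarrow> nat" where
  "cov_hist G 0 y = 0"
| "cov_hist G (Suc x) y = pe (G x (cov_hist G x y) y) (cov_hist G x y)"

definition cov :: "(nat \<Rightarrow> nat \<Rightarrow> nat \<Rightarrow> nat) \<Rightarrow> nat \<Rightarrow> nat \<Rightarrow> nat" where
  "cov G x y = G x (cov_hist G x y) y"

lemma cov_hist_eq: "cov_hist G x y = hist (\<lambda>z. cov G z y) x"
  by (induction x) (simp_all add: cov_def)

lemma cov_unfold: "cov G x y = G x (hist (\<lambda>z. cov G z y) x) y"
  unfolding cov_hist_eq[symmetric] by (rule cov_def)

lemma recf_cov: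
  assumes G: "recf 3 (\<lambda>xs. G (xs ! 0) (xs ! 1) (xs ! 2))" and "recf n g" "recf n h"
  shows "recf n (\<lambda>xs. cov G (g xs) (h xs))"
proof -
  have "recf 3 (\<lambda>xs. pe (G (xs ! 0) (xs ! 1) (xs ! 2)) (xs ! 1))" by (intro recs G)
  then have H: "recf 2 (\<lambda>xs. cov_hist G (xs ! 0) (xs ! 1))"
    by (intro recf_prim_rec[of "\<lambda>y. 0" "\<lambda>x r y. pe (G x r y) r"]) (auto intro!: recs)
  have "recf 2 (\<lambda>xs. cov G (xs ! 0) (xs ! 1))"
    unfolding cov_def by (rule recf_comp3[OF G _ H]) (auto intro!: recs)
  from recf_comp2[OF this assms(2,3)] show ?thesis .
qed

section \<open>The decision procedure\<close>

primrec word_code :: "nat lat_word \<Rightarrow> nat" where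
  "word_code (Gen n) = pe 0 n"
| "word_code (Sup_word s t) = pe 1 (pe (word_code s) (word_code t))"
| "word_code (Inf_word s t) = pe 2 (pe (word_code s) (word_code t))"

lemma psnd_less: "pfst c \<noteq> 0 \<Longrightarrow> psnd c < c"
  using less_pe[of "pfst c" "psnd c"] by (simp add: pe_decode)

lemma child_less:
  assumes "pfst c \<noteq> 0" shows "pfst (psnd c) < c" "psnd (psnd c) < c"
  using psnd_less[OF assms] le_pe(1)[of "pfst (psnd c)" "psnd (psnd c)"]
    le_pe(2)[of "psnd (psnd c)" "pfst (psnd c)"] by (simp_all add: pe_decode)

text \<open>Every number is read as a word, so that the search need not check whether a number codes
  an assignment.\<close>

function word_of :: "nat \<Rightarrow> nat lat_word" where
  "word_of c = (if pfst c = 0 then Gen (psnd c)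
    else if pfst c = 1 then Sup_word (word_of (pfst (psnd c))) (word_of (psnd (psnd c)))
    else Inf_word (word_of (pfst (psnd c))) (word_of (psnd (psnd c))))"
  by auto
termination by (relation "measure id") (auto intro: child_less)

declare word_of.simps [simp del]

lemma word_of_code [simp]: "word_of (word_code w) = w"
  by (induction w) (simp_all add: word_of.simps)

text \<open>The parameter \<open>y\<close> pairs a number \<open>k\<close> with a history of the
  word codes of variables 0 to \<open>k\<close>. Terms and words share their tags, so only leaves
  are replaced.\<close>

definition subst_step :: "nat \<Rightarrow> nat \<Rightarrow> nat \<Rightarrow> nat" where
  "subst_step c h y = (if pfst c = 0 then look (Suc (pfst y)) (psnd y) (psnd c)
    else pe (pfst c) (pe (look c h (pfst (psnd c))) (look c h (psnd (psnd c)))))"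

definition assign :: "nat \<Rightarrow> nat \<Rightarrow> nat lat_word" where
  "assign y n = word_of (look (Suc (pfst y)) (psnd y) n)"

lemma term_code_pe:
  "term_code (Var n) = pe 0 n"
  "term_code (Join s t) = pe 1 (pe (term_code s) (term_code t))"
  "term_code (Meet s t) = pe 2 (pe (term_code s) (term_code t))"
  by (simp_all add: pe_def)

lemma form_code_pe:
  "form_code (Eq s t) = pe 0 (pe (term_code s) (term_code t))"
  "form_code (Le s t) = pe 1 (pe (term_code s) (term_code t))"
  "form_code (Neg p) = pe 2 (form_code p)"
  "form_code (Conj p q) = pe 3 (pe (form_code p) (form_code q))"
  "form_code (Disj p q) = pe 4 (pe (form_code p) (form_code q))"
  "form_code (Impl p q) = pe 5 (pe (form_code p) (form_code q))"
  "form_code (Forall n p) = pe 6 (pe n (form_code p))"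
  "form_code (Exists n p) = pe 7 (pe n (form_code p))"
  by (simp_all add: pe_def)

declare term_code.simps [simp del] form_code.simps [simp del]

lemma less_pe_pe: "0 < t \<Longrightarrow> a < pe t (pe a b)" "0 < t \<Longrightarrow> b < pe t (pe a b)"
  using child_less[of "pe t (pe a b)"] by simp_all

lemma subst_unfold:
  "cov subst_step c y = (if pfst c = 0 then look (Suc (pfst y)) (psnd y) (psnd c)
    else pe (pfst c) (pe (cov subst_step (pfst (psnd c)) y) (cov subst_step (psnd (psnd c)) y)))"
proof -
  define h where "h = hist (\<lambda>z. cov subst_step z y) c"
  have "cov subst_step c y = subst_step c h y" unfolding h_def by (rule cov_unfold)
  moreover have "look c h z = cov subst_step z y" if "z < c" for z
    using look_hist[OF that] h_def by simp
  ultimately show ?thesis using child_less[of c] unfolding subst_step_def[of c h y] by simp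
qed

lemma word_of_subst: "word_of (cov subst_step (term_code s) y) = inst (assign y) s"
  by (induction s)
    (simp_all add: subst_unfold[of "pe _ _"] term_code_pe assign_def word_of.simps[of "pe _ _"])

text \<open>Whitman's recursion on pairs of codes. Pairing is monotone, so passing to a component on
  either side lowers the code. As in \<open>word_of\<close>, all tags above 1 mean meets.\<close>

definition wle_step :: "nat \<Rightarrow> nat \<Rightarrow> nat \<Rightarrow> nat" where
  "wle_step c h y =
    (if pfst (pfst c) = 1 then of_bool (look c h (pe (pfst (psnd (pfst c))) (psnd c)) = 1 \<and>
        look c h (pe (psnd (psnd (pfst c))) (psnd c)) = 1)
    else if \<not> pfst (psnd c) \<le> 1 then of_bool (look c h (pe (pfst c) (pfst (psnd (psnd c)))) = 1 \<and>
        look c h (pe (pfst c) (psnd (psnd (psnd c)))) = 1)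
    else if pfst (pfst c) = 0 then
      (if pfst (psnd c) = 0 then of_bool (psnd (pfst c) = psnd (psnd c))
       else of_bool (look c h (pe (pfst c) (pfst (psnd (psnd c)))) = 1 \<or>
        look c h (pe (pfst c) (psnd (psnd (psnd c)))) = 1))
    else if pfst (psnd c) = 0 then of_bool (look c h (pe (pfst (psnd (pfst c))) (psnd c)) = 1 \<or>
        look c h (pe (psnd (psnd (pfst c))) (psnd c)) = 1)
    else of_bool ((look c h (pe (pfst (psnd (pfst c))) (psnd c)) = 1 \<or>
        look c h (pe (psnd (psnd (pfst c))) (psnd c)) = 1) \<or>
       (look c h (pe (pfst c) (pfst (psnd (psnd c)))) = 1 \<or>
        look c h (pe (pfst c) (psnd (psnd (psnd c)))) = 1)))"

lemma wle_code: "cov wle_step c y = of_bool (wle (word_of (pfst c)) (word_of (psnd c)))"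
proof (induction c rule: less_induct)
  case (less c)
  obtain a b where c: "c = pe a b" using pe_decode by metis
  let ?a1 = "pfst (psnd a)" and ?a2 = "psnd (psnd a)" and ?b1 = "pfst (psnd b)" and ?b2 = "psnd (psnd b)"
  define h where "h = hist (\<lambda>z. cov wle_step z y) c"
  have lk: "look c h (pe a' b') = of_bool (wle (word_of a') (word_of b'))" if "pe a' b' < c" for a' b'
    using less[OF that] look_hist[OF that] h_def by simp
  have A: "look c h (pe ?a1 b) = of_bool (wle (word_of ?a1) (word_of b))"
    "look c h (pe ?a2 b) = of_bool (wle (word_of ?a2) (word_of b))" if "pfst a \<noteq> 0"
    using child_less[OF that] by (intro lk, simp add: c pe_less)+
  have B: "look c h (pe a ?b1) = of_bool (wle (word_of a) (word_of ?b1))"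
    "look c h (pe a ?b2) = of_bool (wle (word_of a) (word_of ?b2))" if "pfst b \<noteq> 0"
    using child_less[OF that] by (intro lk, simp add: c pe_less)+
  have val: "cov wle_step c y = wle_step c h y" unfolding h_def by (rule cov_unfold)
  have pc: "pfst c = a" "psnd c = b" by (simp_all add: c)
  have wa: "word_of a = (if pfst a = 0 then Gen (psnd a) else if pfst a = 1
      then Sup_word (word_of ?a1) (word_of ?a2) else Inf_word (word_of ?a1) (word_of ?a2))"
    and wb: "word_of b = (if pfst b = 0 then Gen (psnd b) else if pfst b = 1
      then Sup_word (word_of ?b1) (word_of ?b2) else Inf_word (word_of ?b1) (word_of ?b2))"
    by (rule word_of.simps)+
  consider "pfst a = 1" | "pfst a \<noteq> 1" "pfst b \<noteq> 0" "pfst b \<noteq> 1"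
    | "pfst a = 0" "pfst b = 0" | "pfst a = 0" "pfst b = 1"
    | "pfst a \<noteq> 0" "pfst a \<noteq> 1" "pfst b = 0" | "pfst a \<noteq> 0" "pfst a \<noteq> 1" "pfst b = 1"
    by blast
  then show ?case
  proof cases
    case 1
    then show ?thesis unfolding val wle_step_def[of c h y] pc using A wa by simp
  next
    case 2
    then show ?thesis unfolding val wle_step_def[of c h y] pc using B wb by (simp add: not_le)
  next
    case 3
    then show ?thesis unfolding val wle_step_def[of c h y] pc using wa wb by simp
  next
    case 4
    then show ?thesis unfolding val wle_step_def[of c h y] pc using B wa wb by simp
  next
    case 5
    then show ?thesis unfolding val wle_step_def[of c h y] pc using A wa wb by simp
  next
    case 6
    then show ?thesis unfolding val wle_step_def[of c h y] pc using A B wa wb by simp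
  qed
qed

text \<open>The last branch serves both quantifiers: it returns the value of the body, in agreement
  with \<open>satw\<close>.\<close>

definition sat_step :: "nat \<Rightarrow> nat \<Rightarrow> nat \<Rightarrow> nat" where
  "sat_step c h y = (let t = pfst c; r = psnd c;
      a = cov subst_step (pfst r) y; b = cov subst_step (psnd r) y;
      p = look c h (pfst r); q = look c h (psnd r) in
    if t = 0 then of_bool (cov wle_step (pe a b) 0 = 1 \<and> cov wle_step (pe b a) 0 = 1)
    else if t = 1 then of_bool (cov wle_step (pe a b) 0 = 1)
    else if t = 2 then of_bool (\<not> look c h r = 1)
    else if t = 3 then of_bool (p = 1 \<and> q = 1)
    else if t = 4 then of_bool (p = 1 \<or> q = 1)
    else if t = 5 then of_bool (p = 1 \<longrightarrow> q = 1)
    else q)"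

text \<open>Under tag 0 a component need not have a smaller code, as 0 itself shows. Equations make
  no recursive call and are unfolded separately.\<close>

lemma sat_unfold:
  assumes "pfst c \<noteq> 0"
  shows "cov sat_step c y = (let t = pfst c; r = psnd c;
      a = cov subst_step (pfst r) y; b = cov subst_step (psnd r) y;
      p = cov sat_step (pfst r) y; q = cov sat_step (psnd r) y in
    if t = 1 then of_bool (cov wle_step (pe a b) 0 = 1)
    else if t = 2 then of_bool (\<not> cov sat_step r y = 1)
    else if t = 3 then of_bool (p = 1 \<and> q = 1)
    else if t = 4 then of_bool (p = 1 \<or> q = 1)
    else if t = 5 then of_bool (p = 1 \<longrightarrow> q = 1)
    else q)"
proof -
  define h where "h = hist (\<lambda>z. cov sat_step z y) c"
  have "cov sat_step c y = sat_step c h y" unfolding h_def by (rule cov_unfold)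
  moreover have "look c h z = cov sat_step z y" if "z < c" for z
    using look_hist[OF that] h_def by simp
  ultimately show ?thesis
    using child_less[OF assms] psnd_less[OF assms] assms unfolding sat_step_def[of c h y] Let_def by simp
qed

lemma sat_unfold_Eq:
  "cov sat_step (pe 0 (pe a b)) y = of_bool (cov wle_step (pe (cov subst_step a y) (cov subst_step b y)) 0 = 1 \<and>
    cov wle_step (pe (cov subst_step b y) (cov subst_step a y)) 0 = 1)"
  by (subst cov_unfold, subst sat_step_def) (simp add: Let_def)

lemma sat_code: "cov sat_step (form_code p) y = of_bool (satw (assign y) p)"
  by (induction p)
    (simp_all add: sat_unfold[of "pe _ _"] sat_unfold_Eq form_code_pe wle_code word_of_subst Let_def)

section \<open>Explicit bounds and the search\<close>

definition grow :: "nat \<Rightarrow> nat \<Rightarrow> nat" where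
  "grow d b = ((\<lambda>r. pe 2 (pe r r)) ^^ d) b"

lemma grow_Suc: "grow (Suc d) b = pe 2 (pe (grow d b) (grow d b))" and grow_0 [simp]: "grow 0 b = b"
  by (simp_all add: grow_def)

lemma grow_le_Suc: "grow d b \<le> grow (Suc d) b"
  unfolding grow_Suc using less_pe_pe(1)[of 2 "grow d b"] by (simp add: less_imp_le)

lemma grow_mono: "d \<le> d' \<Longrightarrow> b \<le> b' \<Longrightarrow> grow d b \<le> grow d' b'"
proof -
  assume "d \<le> d'" "b \<le> b'"
  have "grow d b \<le> grow d b'" by (induction d) (simp_all add: \<open>b \<le> b'\<close> grow_Suc pe_mono)
  also have "\<dots> \<le> grow d' b'" by (rule lift_Suc_mono_le[where f = "\<lambda>d. grow d b'", OF grow_le_Suc \<open>d \<le> d'\<close>])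
  finally show ?thesis .
qed

text \<open>Pairing is monotone and 2 is the largest tag, so each level of a word costs at most one
  iteration in \<open>grow\<close>.\<close>

lemma word_code_le: "set_lat_word w \<subseteq> {..V} \<Longrightarrow> word_code w \<le> grow (height_word w) (pe 0 V)"
proof (induction w)
  case (Gen n) then show ?case by (simp add: pe_mono)
next
  case (Sup_word s t)
  let ?m = "max (height_word s) (height_word t)"
  have "word_code s \<le> grow ?m (pe 0 V)" "word_code t \<le> grow ?m (pe 0 V)"
    using Sup_word le_trans[OF _ grow_mono[OF max.cobounded1 order.refl]]
      le_trans[OF _ grow_mono[OF max.cobounded2 order.refl]] by auto
  then show ?case by (simp add: grow_Suc pe_mono)
next
  case (Inf_word s t)
  let ?m = "max (height_word s) (height_word t)"
  have "word_code s \<le> grow ?m (pe 0 V)" "word_code t \<le> grow ?m (pe 0 V)"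
    using Inf_word le_trans[OF _ grow_mono[OF max.cobounded1 order.refl]]
      le_trans[OF _ grow_mono[OF max.cobounded2 order.refl]] by auto
  then show ?case by (simp add: grow_Suc pe_mono)
qed

lemma hist_le: "(\<And>x. f x \<le> b) \<Longrightarrow> hist f x \<le> grow x b"
proof (induction x)
  case (Suc x)
  have "f x \<le> grow x b" using Suc.prems[of x] grow_mono[of 0 x b b] by simp
  then have "hist f (Suc x) \<le> pe (grow x b) (grow x b)" using Suc by (simp add: pe_mono)
  also have "\<dots> \<le> grow (Suc x) b" unfolding grow_Suc by (rule le_pe)
  finally show ?case .
qed simp

text \<open>The inner \<open>grow\<close> bounds the code of one word, the outer one a history of
  \<open>Suc k\<close> such words.\<close>

definition search_bd :: "nat \<Rightarrow> nat" where
  "search_bd k = grow (Suc k) (grow (height_bd (Suc k)) (pe 0 (pos_bd (Suc k) + 2)))"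

definition decide :: "nat \<Rightarrow> nat" where
  "decide k = (if \<exists>z<Suc (search_bd k). cov sat_step k (pe k z) = 0 then 0 else 1)"

lemma le_peI: "n \<le> a \<Longrightarrow> n \<le> pe t (pe a b)" "n \<le> b \<Longrightarrow> n \<le> pe t (pe a b)" "n \<le> b \<Longrightarrow> n \<le> pe t b"
  using le_pe le_trans by blast+

lemma term_var_le: "n \<in> term_vars s \<Longrightarrow> n \<le> term_code s"
  by (induction s) (auto simp: term_code_pe intro: le_peI)

lemma subterm_code_le: "t \<in> subterms s \<Longrightarrow> term_code t \<le> term_code s"
  by (induction s) (auto simp: term_code_pe intro: le_peI)

lemma atom_term_code_le: "s \<in> atom_terms p \<Longrightarrow> term_code s \<le> form_code p"
  by (induction p) (auto simp: form_code_pe intro: le_peI)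

lemma inst_cong: "(\<And>n. n \<in> term_vars s \<Longrightarrow> \<theta> n = \<eta> n) \<Longrightarrow> inst \<theta> s = inst \<eta> s"
  by (induction s) auto

lemma atom_terms_nonempty: "atom_terms p \<noteq> {}"
  by (induction p) auto

text \<open>The code \<open>k\<close> controls all sizes: variables are at most \<open>k\<close>,
  and subterms have distinct codes up to \<open>k\<close>, so there are at most \<open>Suc k\<close>
  of them.\<close>

lemma ex_bounded_refutation:
  fixes \<theta> :: "nat \<Rightarrow> nat lat_word"
  assumes "\<not> satw \<theta> p"
  shows "\<exists>z\<le>search_bd (form_code p). \<not> satw (assign (pe (form_code p) z)) p"
proof -
  define k where "k = form_code p"
  define S where "S = (\<Union>s\<in>atom_terms p. subterms s)"
  have fS: "finite S" by (simp add: S_def)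
  have codes: "term_code ` S \<subseteq> {..k}"
    unfolding S_def k_def using subterm_code_le atom_term_code_le by (blast intro: le_trans)
  have "inj_on term_code S" by (simp add: inj_on_def term_code_inject)
  from card_inj_on_le[OF this codes] have cS: "card S \<le> Suc k" by simp
  obtain xs where xs: "set xs = S" "distinct xs" using finite_distinct_list[OF fS] by blast
  have ne: "xs \<noteq> []" using xs(1) atom_terms_nonempty[of p] subterms_self unfolding S_def by fastforce
  \<comment> \<open>Padding with repetitions makes the length exactly \<open>Suc k\<close>, so that
    the bounds depend on \<open>k\<close> alone.\<close>
  define sl where "sl = xs @ replicate (Suc k - length xs) (hd xs)"
  have sl: "set sl = S" "length sl = Suc k"
    using xs ne cS distinct_card[OF xs(2)] by (auto simp: sl_def)
  have cl: "q \<in> set sl \<and> r \<in> set sl" if jm: "Join q r \<in> set sl \<or> Meet q r \<in> set sl" for q r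
  proof -
    obtain s where s: "s \<in> atom_terms p" "Join q r \<in> subterms s \<or> Meet q r \<in> subterms s"
      using jm unfolding sl S_def by blast
    have "{q, r} \<subseteq> subterms (Join q r)" "{q, r} \<subseteq> subterms (Meet q r)" by simp_all
    with s(2) have "{q, r} \<subseteq> subterms s"
      using subterms_trans[of "Join q r" s] subterms_trans[of "Meet q r" s] by (metis subset_trans)
    then show ?thesis using s(1) unfolding sl S_def by blast
  qed
  obtain \<theta>' :: "nat \<Rightarrow> nat lat_word" where
    eq: "\<forall>s\<in>set sl. \<forall>t\<in>set sl. wle (inst \<theta>' s) (inst \<theta>' t) \<longleftrightarrow> wle (inst \<theta> s) (inst \<theta> t)"
    and bd: "\<And>n. height_word (\<theta>' n) \<le> height_bd (Suc k)" "\<And>n. set_lat_word (\<theta>' n) \<subseteq> {..pos_bd (Suc k) + 2}"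
    using bounded_solution[of sl \<theta>, OF cl cl] unfolding sl(2) by blast
  define z where "z = hist (\<lambda>n. word_code (\<theta>' n)) (Suc k)"
  have "word_code (\<theta>' n) \<le> grow (height_bd (Suc k)) (pe 0 (pos_bd (Suc k) + 2))" for n
    using word_code_le[OF bd(2)] grow_mono[OF bd(1) order.refl] by (rule le_trans)
  from hist_le[OF this] have zb: "z \<le> search_bd k" unfolding z_def search_bd_def .
  have as: "assign (pe k z) n = \<theta>' n" if "n \<le> k" for n
    using that look_hist[of n "Suc k" "\<lambda>n. word_code (\<theta>' n)"] unfolding assign_def z_def pfst_pe psnd_pe
    by (simp del: hist.simps)
  have inst: "inst (assign (pe k z)) s = inst \<theta>' s" if "s \<in> atom_terms p" for s
    using as term_var_le atom_term_code_le[OF that] k_def by (intro inst_cong) (metis le_trans)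
  have sub: "atom_terms p \<subseteq> set sl" unfolding sl S_def by auto
  have "satw (assign (pe k z)) p \<longleftrightarrow> satw \<theta> p"
    by (rule satw_cong) (use inst eq sub in \<open>auto simp: subset_eq\<close>)
  with assms zb show ?thesis unfolding k_def by blast
qed

lemma decide_correct: "decide (form_code p) = (if \<forall>\<theta> :: nat \<Rightarrow> nat lat_word. satw \<theta> p then 1 else 0)"
proof -
  have "(\<exists>z<Suc (search_bd (form_code p)). \<not> satw (assign (pe (form_code p) z)) p) \<longleftrightarrow>
      (\<exists>\<theta> :: nat \<Rightarrow> nat lat_word. \<not> satw \<theta> p)"
    using ex_bounded_refutation[of _ p] unfolding less_Suc_eq_le by blast
  then show ?thesis unfolding decide_def sat_code by simp
qed

lemma recf_subst [recs]: "recf n g \<Longrightarrow> recf n h \<Longrightarrow> recf n (\<lambda>xs. cov subst_step (g xs) (h xs))"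
  by (rule recf_cov) (unfold subst_step_def, intro recs)

lemma recf_wle [recs]: "recf n g \<Longrightarrow> recf n h \<Longrightarrow> recf n (\<lambda>xs. cov wle_step (g xs) (h xs))"
  by (rule recf_cov) (unfold wle_step_def, intro recs)

lemma recf_sat [recs]: "recf n g \<Longrightarrow> recf n h \<Longrightarrow> recf n (\<lambda>xs. cov sat_step (g xs) (h xs))"
  by (rule recf_cov) (unfold sat_step_def Let_def, intro recs)

lemma recf_grow [recs]:
  assumes "recf n g" "recf n h" shows "recf n (\<lambda>xs. grow (g xs) (h xs))"
proof -
  have "recf 2 (\<lambda>xs. grow (xs ! 0) (xs ! 1))"
    by (rule recf_prim_rec[of "\<lambda>y. y" "\<lambda>x r y. pe 2 (pe r r)"]) (simp_all add: grow_Suc, (intro recs)+)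
  from recf_comp2[OF this assms] show ?thesis .
qed

lemma recf_decide: "recf 1 (\<lambda>xs. decide (xs ! 0))"
proof -
  have "recf 1 (\<lambda>xs. search_bd (xs ! 0))"
    unfolding search_bd_def height_bd_def pos_bd_def by (intro recs)
  moreover have "recp 2 (\<lambda>xs. cov sat_step (xs ! 1) (pe (xs ! 1) (xs ! 0)) = 0)"
    by (intro recs)
  ultimately have "recp 1 (\<lambda>xs. \<exists>z<Suc (search_bd (xs ! 0)). cov sat_step (xs ! 0) (pe (xs ! 0) z) = 0)"
    by (intro recp_ex_less[of "\<lambda>z k. cov sat_step k (pe k z) = 0"] recs)
  then show ?thesis unfolding decide_def by (rule recf_if) (intro recs)+
qed

theorem theorem1p1:
  "decidable_universal_theory TYPE(3 free_lattice) \<and>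
    (infinite (UNIV :: 'a set) \<or> CARD('a) \<ge> 3 \<longrightarrow>
      (\<forall>p. universal_sentence p \<longrightarrow>
        (holds_in TYPE('a free_lattice) p \<longleftrightarrow> holds_in TYPE(3 free_lattice) p)))"
proof -
  have three: "holds_in TYPE(3 free_lattice) p \<longleftrightarrow> (\<forall>\<theta> :: nat \<Rightarrow> nat lat_word. satw \<theta> p)"
    if "universal_sentence p" for p
    using that holds_in_iff[of p, where 'a = 3] satw_all_iff[where 'a = 3]
    by (simp add: universal_sentence_def)
  obtain f where f: "total_recursive 1 f" "\<forall>xs. length xs = 1 \<longrightarrow> f xs = decide (xs ! 0)"
    using recf_decide recf_def by auto
  have "f [form_code p] = (if holds_in TYPE(3 free_lattice) p then 1 else 0)"
    if "universal_sentence p" for p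
    using f(2) decide_correct[of p] three[OF that] by simp
  with f(1) have "decidable_universal_theory TYPE(3 free_lattice)"
    unfolding decidable_universal_theory_def by blast
  moreover have "holds_in TYPE('a free_lattice) p \<longleftrightarrow> holds_in TYPE(3 free_lattice) p"
    if "infinite (UNIV :: 'a set) \<or> CARD('a) \<ge> 3" "universal_sentence p" for p
    unfolding three[OF that(2)] using holds_in_iff[of p, where 'a = 'a] satw_all_iff[OF that(1)] that(2)
    by (simp add: universal_sentence_def)
  ultimately show ?thesis by blast
qed

end
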